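(* Principal-value log--exp terms are computationally universal under iteration, and the terms may be chosen without constants. That is, there exist a fixed universal tag system $T_*$, a computable input encoding $c$ of the words of $T_*$ as natural numbers, and a fixed log--exp term $F$ in one variable, containing no constants, such that $F$ is defined at $c(w)$ and $$F(c(w))=c(\operatorname{step}_{T_*}(w))$$ for every nonhalting configuration (word) $w$ of $T_*$.
   Context: Principal values: for $z\in\mathbb{C}\setminus\{0\}$, $\operatorname{Log} z=\log|z|+i\operatorname{Arg} z$ with $\operatorname{Arg} z\in(-\pi,\pi]$. For $x\neq 0$, $x^y:=e^{y\operatorname{Log}x}$; for $a,b\ne0$ with $b\neq1$, $\log_b a:=\operatorname{Log}a/\operatorname{Log}b$. A log--exp term is a finite term built from the two binary operations $x^y$ and $\log_b a$, along with one or more variables and/or constants. It denotes a partial function: an input is outside its domain if any subterm asks for one of the excluded logarithms or bases. A term without constants has only variables as leaves. A tag system $T=(v,\Sigma,P)$ consists of an integer deletion number $v\ge2$, a finite alphabet $\Sigma$, and a production map $P:\Sigma\to\Sigma^*$. From a word $w=w_1\cdots w_n$ with $n\ge v$, one step deletes $w_1\cdots w_v$ and appends $P(w_1)$; that is, $\operatorname{step}_T(w)=w_{v+1}\cdots w_n P(w_1)$. The system halts when $n<v$; a configuration $w$ is nonhalting if its length is at least $v$. A partial map $F$ orbit-simulates a tag system $T$ under an encoding $c$ (an injective map from words to numbers) if $F(c(w))=c(\operatorname{step}_T(w))$ for every nonhalting configuration $w$. A term language is computationally universal under iteration if it contains a fixed term that orbit-simulates a fixed universal tag system under a computable input encoding.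 A tag system is universal, in the standard sense, if it simulates a universal Turing machine: there is a computable map from inputs of a fixed universal Turing machine to words of the tag system such that the machine halts on an input iff the tag system, started on the corresponding word, halts (reaches a word of length less than $v$). *)

theory Defs
  imports "HOL-Analysis.Analysis" "HOL-Library.Nat_Bijection"
begin

section \<open>Log--exp terms\<close>

text \<open>\<open>Pow x y\<close> stands for \<open>x\<^sup>y\<close>, and \<open>Log b a\<close> for the logarithm of \<open>a\<close> to base \<open>b\<close>.\<close>

datatype lexp = Var nat | Const complex | Pow lexp lexp | Log lexp lexp

text \<open>
  The library's \<open>Ln\<close> is the principal logarithm, with imaginary part in \<open>(-\<pi>, \<pi>]\<close>, and for
  \<open>x \<noteq> 0\<close> the library's \<open>x powr y\<close> is \<open>exp (y * Ln x)\<close>. Both are total in the library;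
  the excluded arguments and bases are the ones that yield \<open>None\<close> here.
\<close>

fun lexp_eval :: "(nat \<Rightarrow> complex) \<Rightarrow> lexp \<Rightarrow> complex option" where
  "lexp_eval \<rho> (Var i) = Some (\<rho> i)"
| "lexp_eval \<rho> (Const k) = Some k"
| "lexp_eval \<rho> (Pow s t) =
     (case (lexp_eval \<rho> s, lexp_eval \<rho> t) of
        (Some x, Some y) \<Rightarrow> if x \<noteq> 0 then Some (x powr y) else None
      | _ \<Rightarrow> None)"
| "lexp_eval \<rho> (Log s t) =
     (case (lexp_eval \<rho> s, lexp_eval \<rho> t) of
        (Some b, Some a) \<Rightarrow> if a \<noteq> 0 \<and> b \<noteq> 0 \<and> b \<noteq> 1 then Some (Ln a / Ln b) else None
      | _ \<Rightarrow> None)"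

fun lexp_vars :: "lexp \<Rightarrow> nat set" where
  "lexp_vars (Var i) = {i}"
| "lexp_vars (Const k) = {}"
| "lexp_vars (Pow s t) = lexp_vars s \<union> lexp_vars t"
| "lexp_vars (Log s t) = lexp_vars s \<union> lexp_vars t"

fun constant_free :: "lexp \<Rightarrow> bool" where
  "constant_free (Var i) \<longleftrightarrow> True"
| "constant_free (Const k) \<longleftrightarrow> False"
| "constant_free (Pow s t) \<longleftrightarrow> constant_free s \<and> constant_free t"
| "constant_free (Log s t) \<longleftrightarrow> constant_free s \<and> constant_free t"

text \<open>The partial map denoted by a term whose only variable is \<open>Var 0\<close>.\<close>

definition lexp_map :: "lexp \<Rightarrow> complex \<rightharpoonup> complex" where
  "lexp_map F z = lexp_eval (\<lambda>_. z) F"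


section \<open>Tag systems\<close>

record 'a tag_system =
  deletion :: nat
  alphabet :: "'a set"
  production :: "'a \<Rightarrow> 'a list"

definition tag_system :: "'a tag_system \<Rightarrow> bool" where
  "tag_system T \<longleftrightarrow> deletion T \<ge> 2 \<and> finite (alphabet T) \<and>
     (\<forall>a\<in>alphabet T. production T a \<in> lists (alphabet T))"

abbreviation tag_words :: "'a tag_system \<Rightarrow> 'a list set" where
  "tag_words T \<equiv> lists (alphabet T)"

definition tag_nonhalting :: "'a tag_system \<Rightarrow> 'a list \<Rightarrow> bool" where
  "tag_nonhalting T w \<longleftrightarrow> length w \<ge> deletion T"

definition tag_step :: "'a tag_system \<Rightarrow> 'a list \<Rightarrow> 'a list" where
  "tag_step T w = drop (deletion T) w @ production T (hd w)"

definition tag_halts :: "'a tag_system \<Rightarrow> 'a list \<Rightarrow> bool" where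
  "tag_halts T w \<longleftrightarrow>
     (\<exists>w'. (\<lambda>u u'. tag_nonhalting T u \<and> u' = tag_step T u)\<^sup>*\<^sup>* w w' \<and> \<not> tag_nonhalting T w')"

definition orbit_simulates ::
    "(complex \<rightharpoonup> complex) \<Rightarrow> 'a tag_system \<Rightarrow> ('a list \<Rightarrow> complex) \<Rightarrow> bool" where
  "orbit_simulates F T c \<longleftrightarrow> inj_on c (tag_words T) \<and>
     (\<forall>w\<in>tag_words T. tag_nonhalting T w \<longrightarrow> F (c w) = Some (c (tag_step T w)))"


section \<open>Computable maps\<close>

text \<open>
  The total recursive functions: \<open>recursive n f\<close> says that \<open>f\<close>, restricted to lists of length \<open>n\<close>,
  is a total recursive function of \<open>n\<close> arguments (its values on other lists are irrelevant).
  Minimisation is applied only where it yields a total function.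
\<close>

inductive recursive :: "nat \<Rightarrow> (nat list \<Rightarrow> nat) \<Rightarrow> bool" where
  zero: "recursive n (\<lambda>xs. 0)"
| succ: "recursive 1 (\<lambda>xs. Suc (xs ! 0))"
| proj: "i < n \<Longrightarrow> recursive n (\<lambda>xs. xs ! i)"
| comp: "recursive (length gs) f \<Longrightarrow> (\<forall>g\<in>set gs. recursive n g) \<Longrightarrow>
         recursive n (\<lambda>xs. f (map (\<lambda>g. g xs) gs))"
| prim: "recursive n f \<Longrightarrow> recursive (Suc (Suc n)) g \<Longrightarrow>
         recursive (Suc n) (\<lambda>xs. rec_nat (f (tl xs)) (\<lambda>k r. g (k # r # tl xs)) (hd xs))"
| mini: "recursive (Suc n) f \<Longrightarrow> (\<forall>xs. length xs = n \<longrightarrow> (\<exists>y. f (y # xs) = 0)) \<Longrightarrow>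
         recursive n (\<lambda>xs. LEAST y. f (y # xs) = 0)"

text \<open>
  Computability of \<open>f\<close> on \<open>A\<close>, relative to numberings of inputs and outputs. It is used only for
  sets \<open>A\<close> whose set of codes is decidable, so that asking for a total recursive function that
  agrees with \<open>f\<close> on \<open>A\<close> is no restriction.
\<close>

definition computable_on ::
    "('a \<Rightarrow> nat) \<Rightarrow> ('b \<Rightarrow> nat) \<Rightarrow> 'a set \<Rightarrow> ('a \<Rightarrow> 'b) \<Rightarrow> bool" where
  "computable_on code_in code_out A f \<longleftrightarrow>
     (\<exists>g. recursive 1 g \<and> (\<forall>x\<in>A. g [code_in x] = code_out (f x)))"


section \<open>Turing machines\<close>

text \<open>
  Deterministic one-tape machines, given by a finite table of quintuples \<open>((q, a), (q', b, d))\<close>: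
  in state \<open>q\<close> reading \<open>a\<close>, write \<open>b\<close>, move in direction \<open>d\<close> and enter state \<open>q'\<close>. If several
  entries have the same key, the first one counts; a machine halts when no entry applies.
  State \<open>0\<close> is the initial state and symbol \<open>0\<close> is the blank.
\<close>

datatype direction = L | R

type_synonym turing_machine = "((nat \<times> nat) \<times> (nat \<times> nat \<times> direction)) list"

definition tm_alphabet :: "turing_machine \<Rightarrow> nat set" where
  "tm_alphabet M = insert 0 (\<Union>((q, a), (q', b, d))\<in>set M. {a, b})"

definition tm_inputs :: "turing_machine \<Rightarrow> nat list set" where
  "tm_inputs M = lists (tm_alphabet M - {0})"

text \<open>
  A configuration \<open>(q, l, r)\<close> has state \<open>q\<close>; the two-way infinite tape carries \<open>rev l @ r\<close>, with
  blanks on either side, and the head is on the first cell of \<open>r\<close>.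
\<close>

type_synonym tm_config = "nat \<times> nat list \<times> nat list"

fun tape_hd :: "nat list \<Rightarrow> nat" where
  "tape_hd [] = 0"
| "tape_hd (a # _) = a"

fun tm_step :: "turing_machine \<Rightarrow> tm_config \<Rightarrow> tm_config option" where
  "tm_step M (q, l, r) =
     (case map_of M (q, tape_hd r) of
        None \<Rightarrow> None
      | Some (q', b, R) \<Rightarrow> Some (q', b # l, tl r)
      | Some (q', b, L) \<Rightarrow> Some (q', tl l, tape_hd l # b # tl r))"

text \<open>
  The head starts on the first letter of the input; the output is the word that extends from the
  final head position up to the first blank.
\<close>

definition tm_computes :: "turing_machine \<Rightarrow> nat list \<Rightarrow> nat list \<Rightarrow> bool" where
  "tm_computes M x y \<longleftrightarrow>
     (\<exists>q l r. (\<lambda>C C'. tm_step M C = Some C')\<^sup>*\<^sup>* (0, [], x) (q, l, r) \<and>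
        tm_step M (q, l, r) = None \<and> y = takeWhile (\<lambda>a. a \<noteq> 0) r)"

definition tm_halts :: "turing_machine \<Rightarrow> nat list \<Rightarrow> bool" where
  "tm_halts M x \<longleftrightarrow> (\<exists>y. tm_computes M x y)"

fun direction_code :: "direction \<Rightarrow> nat" where
  "direction_code L = 0"
| "direction_code R = 1"

fun quintuple_code :: "(nat \<times> nat) \<times> (nat \<times> nat \<times> direction) \<Rightarrow> nat" where
  "quintuple_code ((q, a), (q', b, d)) = list_encode [q, a, q', b, direction_code d]"

fun tm_input_code :: "turing_machine \<times> nat list \<Rightarrow> nat" where
  "tm_input_code (M, x) = prod_encode (list_encode (map quintuple_code M), list_encode x)"

text \<open>
  \<open>U\<close> is universal if it simulates every machine \<open>M\<close> on every input \<open>x\<close> of \<open>M\<close>, from a computable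
  description of the pair: it halts iff \<open>M\<close> does, and the output of \<open>M\<close> is recovered computably
  from that of \<open>U\<close>. A decoding is needed because the alphabet of \<open>U\<close> is fixed and that of \<open>M\<close> is
  arbitrary.
\<close>

definition universal_tm :: "turing_machine \<Rightarrow> bool" where
  "universal_tm U \<longleftrightarrow>
     (\<exists>enc dec.
        computable_on tm_input_code list_encode {(M, x). x \<in> tm_inputs M} enc \<and>
        computable_on list_encode list_encode UNIV dec \<and>
        (\<forall>M. \<forall>x\<in>tm_inputs M.
           enc (M, x) \<in> tm_inputs U \<and>
           (tm_halts U (enc (M, x)) \<longleftrightarrow> tm_halts M x) \<and>
           (\<forall>y z. tm_computes M x y \<longrightarrow> tm_computes U (enc (M, x)) z \<longrightarrow> dec z = y)))"

definition universal_tag_system :: "nat tag_system \<Rightarrow> bool" where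
  "universal_tag_system T \<longleftrightarrow> tag_system T \<and>
     (\<exists>U. universal_tm U \<and>
        (\<exists>g. computable_on list_encode list_encode (tm_inputs U) g \<and>
             (\<forall>x\<in>tm_inputs U. g x \<in> tag_words T \<and> (tm_halts U x \<longleftrightarrow> tag_halts T (g x)))))"

end

theory Submission
  imports Defs "HOL-Computational_Algebra.Primes" "HOL-Library.Infinite_Set"
begin

text \<open>
  Two constructions meet in the theorem: a universal tag system, and a way of writing one step of
  any tag system as a log--exp term.

  The term. Let \<open>x > 1\<close> be real. Then \<open>log\<^sub>x ((x\<^sup>a)\<^sup>b) = a b\<close>, \<open>log\<^sub>x (x\<^sup>a x\<^sup>b) = a + b\<close> and
  \<open>log\<^bsub>x^b\<^esub> (x\<^sup>a) = a / b\<close>, while \<open>log\<^sub>x x = 1\<close>, \<open>log\<^sub>x 1 = 0\<close> and \<open>log\<^bsub>1/x\<^esub> x = -1\<close>. So the constant-free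
  terms in one variable denote, away from the poles, all rational functions of \<open>x\<close> with integer
  coefficients, and among them the constant \<open>-1\<close>. The branch cut now yields what no real-analytic function could: the
  principal value of \<open>log\<^bsub>-1\<^esub> ((-1)\<^sup>y)\<close> is the representative of \<open>y\<close> modulo \<open>2\<close> in \<open>(-1, 1]\<close>, and
  from it the floor function is obtained by arithmetic (\<open>expressible_floor\<close>). Division with
  remainder, finite tables and powers of a base \<open>B\<close> follow. If a word is coded by the number
  whose base-\<open>B\<close> digits are its letters plus one, then a tag step takes the leading digit,
  removes the leading \<open>v\<close> digits, shifts, and adds an entry of a finite table
  (\<open>tag_step_expressible\<close>). This works for every tag system.

  The universal tag system. The step of a Turing machine, coded together with the machine, is a
  recursive function \<open>\<Phi>\<close> of one number. Every total recursive function is computed by a program with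
  finitely many counters, so one fixed counter program iterates \<open>\<Phi>\<close> until the simulated machine
  halts (\<open>orbit_counter_program\<close>). This program is simulated twice. A one-tape machine stores the
  counters on the parallel tracks of its tape; since its halting and its output are those of the
  iteration, it is universal (\<open>universal_tmI\<close>, \<open>counter_tm_computes\<close>). A tag system stores the
  counters as the exponents of distinct primes in a number \<open>N\<close>, written in unary; that it can
  divide by a prime, and notice when this fails, rests on the fact that a tag system sees the length
  of its word modulo the deletion number as the position at which it starts to read the next pass
  (\<open>tag_halts_tag_word\<close>). Both simulations start from the same counter contents, namely the length
  of the input word, so halting is transferred from the universal machine to the tag system.
\<close>


section \<open>Total recursive functions\<close>

text \<open>
  The inductive predicate \<open>recursive\<close> also fixes the values on lists of the wrong length, which
  depend on the way the function was built. Closing it under agreement on the lists of length \<open>n\<close>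
  gives a class in which a function may be replaced by another description of itself.
\<close>

definition total_recursive :: "nat \<Rightarrow> (nat list \<Rightarrow> nat) \<Rightarrow> bool" where
  "total_recursive n f \<longleftrightarrow> (\<exists>g. recursive n g \<and> (\<forall>xs. length xs = n \<longrightarrow> g xs = f xs))"

lemma total_recursive_cong:
  assumes "total_recursive n f" "\<And>xs. length xs = n \<Longrightarrow> f xs = g xs"
  shows "total_recursive n g"
  using assms unfolding total_recursive_def by metis

lemma total_recursive_comp:
  assumes f: "total_recursive (length gs) f" and gs: "\<And>g. g \<in> set gs \<Longrightarrow> total_recursive n g"
  shows "total_recursive n (\<lambda>xs. f (map (\<lambda>g. g xs) gs))"
proof -
  obtain f' where f': "recursive (length gs) f'" "\<And>xs. length xs = length gs \<Longrightarrow> f' xs = f xs"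
    using f unfolding total_recursive_def by blast
  have "\<exists>h. \<forall>g\<in>set gs. recursive n (h g) \<and> (\<forall>xs. length xs = n \<longrightarrow> h g xs = g xs)"
    using gs unfolding total_recursive_def by (intro bchoice) blast
  then obtain h where h: "\<And>g. g \<in> set gs \<Longrightarrow> recursive n (h g)"
    "\<And>g xs. g \<in> set gs \<Longrightarrow> length xs = n \<Longrightarrow> h g xs = g xs" by blast
  have "recursive n (\<lambda>xs. f' (map (\<lambda>g. g xs) (map h gs)))"
    using f' h by (intro recursive.comp) auto
  moreover have "f' (map (\<lambda>g. g xs) (map h gs)) = f (map (\<lambda>g. g xs) gs)" if "length xs = n" for xs
  proof -
    have "map (\<lambda>g. g xs) (map h gs) = map (\<lambda>g. g xs) gs" using h(2) that by simp
    then show ?thesis using f'(2) by (simp only: length_map)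
  qed
  ultimately show ?thesis unfolding total_recursive_def by blast
qed

lemma total_recursive_proj: "i < n \<Longrightarrow> total_recursive n (\<lambda>xs. xs ! i)"
  unfolding total_recursive_def using recursive.proj by blast

lemma total_recursive_comp1:
  assumes "total_recursive 1 (\<lambda>ys. F (ys ! 0))" "total_recursive n f"
  shows "total_recursive n (\<lambda>xs. F (f xs))"
  using total_recursive_comp[of "[f]" "\<lambda>ys. F (ys ! 0)" n] assms by simp

lemma total_recursive_comp3:
  assumes "total_recursive 3 (\<lambda>ys. F (ys ! 0) (ys ! 1) (ys ! 2))"
    "total_recursive n f" "total_recursive n g" "total_recursive n h"
  shows "total_recursive n (\<lambda>xs. F (f xs) (g xs) (h xs))"
  using total_recursive_comp[of "[f, g, h]" "\<lambda>ys. F (ys ! 0) (ys ! 1) (ys ! 2)" n] assms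
  by (simp add: numeral_3_eq_3 numeral_2_eq_2 disj_imp) metis

lemma total_recursive_Suc [intro]:
  assumes "total_recursive n f" shows "total_recursive n (\<lambda>xs. Suc (f xs))"
proof (rule total_recursive_comp1[where F = Suc, OF _ assms])
  show "total_recursive 1 (\<lambda>ys. Suc (ys ! 0))"
    unfolding total_recursive_def using recursive.succ by blast
qed

lemma total_recursive_const: "total_recursive n (\<lambda>xs. k)"
proof (induction k)
  case 0
  then show ?case unfolding total_recursive_def using recursive.zero by blast
qed (rule total_recursive_Suc)

text \<open>
  In the step function of a primitive recursion the parameters follow the counter and the previous
  value; this rule lets a function of the parameters be used there.
\<close>

lemma total_recursive_tail:
  assumes "total_recursive n f" shows "total_recursive (n + k) (\<lambda>ys. f (drop k ys))"
proof -
  let ?gs = "map (\<lambda>i ys. ys ! (i + k)) [0..<n] :: (nat list \<Rightarrow> nat) list"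
  have "total_recursive (n + k) (\<lambda>xs. f (map (\<lambda>g. g xs) ?gs))"
    using assms by (intro total_recursive_comp) (auto intro!: total_recursive_proj)
  then show ?thesis
  proof (rule total_recursive_cong)
    fix xs :: "nat list" assume "length xs = n + k"
    then have "map (\<lambda>g. g xs) ?gs = drop k xs"
      by (intro nth_equalityI) (auto simp: add.commute)
    then show "f (map (\<lambda>g. g xs) ?gs) = f (drop k xs)" by simp
  qed
qed

lemma total_recursive_tail2:
  "total_recursive n f \<Longrightarrow> total_recursive (Suc (Suc n)) (\<lambda>ys. f (drop 2 ys))"
  using total_recursive_tail[of n f 2] by simp

lemma total_recursive_rec_nat:
  assumes a: "total_recursive n a"
    and g: "total_recursive (Suc (Suc n)) (\<lambda>ys. g (ys ! 0) (ys ! 1) (drop 2 ys))"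
    and c: "total_recursive n c"
  shows "total_recursive n (\<lambda>xs. rec_nat (a xs) (\<lambda>k r. g k r xs) (c xs))"
proof -
  obtain a' where a': "recursive n a'" "\<And>xs. length xs = n \<Longrightarrow> a' xs = a xs"
    using a unfolding total_recursive_def by blast
  obtain g' where g': "recursive (Suc (Suc n)) g'"
    "\<And>ys. length ys = Suc (Suc n) \<Longrightarrow> g' ys = g (ys ! 0) (ys ! 1) (drop 2 ys)"
    using g unfolding total_recursive_def by blast
  let ?h = "\<lambda>ys. rec_nat (a' (tl ys)) (\<lambda>k r. g' (k # r # tl ys)) (hd ys)"
  let ?gs = "c # map (\<lambda>i ys. ys ! i) [0..<n]"
  have "recursive (Suc n) ?h" using a'(1) g'(1) by (rule recursive.prim)
  then have "total_recursive (length ?gs) ?h" unfolding total_recursive_def by auto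
  then have "total_recursive n (\<lambda>xs. ?h (map (\<lambda>g. g xs) ?gs))"
    using c by (intro total_recursive_comp[where f = ?h and gs = ?gs]) (auto intro!: total_recursive_proj)
  then show ?thesis
  proof (rule total_recursive_cong)
    fix xs :: "nat list" assume len: "length xs = n"
    have "map (\<lambda>g. g xs) ?gs = c xs # xs"
      using len by (simp add: o_def) (metis map_nth)
    then show "?h (map (\<lambda>g. g xs) ?gs) = rec_nat (a xs) (\<lambda>k r. g k r xs) (c xs)"
      using len a'(2) g'(2) by simp
  qed
qed

lemma total_recursive_Least:
  assumes f: "total_recursive (Suc n) (\<lambda>ys. f (ys ! 0) (tl ys))"
    and ex: "\<And>xs. length xs = n \<Longrightarrow> \<exists>y. f y xs = 0"
  shows "total_recursive n (\<lambda>xs. LEAST y. f y xs = 0)"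
proof -
  obtain f' where f': "recursive (Suc n) f'"
    "\<And>ys. length ys = Suc n \<Longrightarrow> f' ys = f (ys ! 0) (tl ys)"
    using f unfolding total_recursive_def by blast
  have "recursive n (\<lambda>xs. LEAST y. f' (y # xs) = 0)"
    using f' ex by (intro recursive.mini) auto
  then show ?thesis
    unfolding total_recursive_def using f'(2) by (intro exI[of _ "\<lambda>xs. LEAST y. f' (y # xs) = 0"]) simp
qed

named_theorems recs

lemmas [recs] = total_recursive_const total_recursive_proj total_recursive_Suc

lemma total_recursive_add [recs]:
  assumes "total_recursive n f" "total_recursive n g"
  shows "total_recursive n (\<lambda>xs. f xs + g xs)"
proof -
  have "total_recursive n (\<lambda>xs. rec_nat (f xs) (\<lambda>k r. Suc r) (g xs))"
    using assms by (intro total_recursive_rec_nat recs) auto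
  moreover have "rec_nat a (\<lambda>k r. Suc r) b = a + b" for a b by (induction b) auto
  ultimately show ?thesis by simp
qed

lemma total_recursive_mult [recs]:
  assumes "total_recursive n f" "total_recursive n g"
  shows "total_recursive n (\<lambda>xs. f xs * g xs)"
proof -
  have "total_recursive n (\<lambda>xs. rec_nat 0 (\<lambda>k r. r + f xs) (g xs))"
    using assms by (intro total_recursive_rec_nat recs total_recursive_tail2) auto
  moreover have "rec_nat 0 (\<lambda>k r. r + a) b = a * b" for a b by (induction b) auto
  ultimately show ?thesis by simp
qed

lemma total_recursive_power [recs]:
  assumes "total_recursive n f" "total_recursive n g"
  shows "total_recursive n (\<lambda>xs. f xs ^ g xs)"
proof -
  have "total_recursive n (\<lambda>xs. rec_nat 1 (\<lambda>k r. r * f xs) (g xs))"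
    using assms by (intro total_recursive_rec_nat recs total_recursive_tail2) auto
  moreover have "rec_nat 1 (\<lambda>k r. r * a) b = a ^ b" for a b :: nat by (induction b) auto
  ultimately show ?thesis by simp
qed

lemma total_recursive_pred:
  assumes "total_recursive n f"
  shows "total_recursive n (\<lambda>xs. f xs - 1)"
proof -
  have "total_recursive n (\<lambda>xs. rec_nat 0 (\<lambda>k r. k) (f xs))"
    using assms by (intro total_recursive_rec_nat recs) auto
  moreover have "rec_nat 0 (\<lambda>k r. k) b = b - 1" for b by (cases b) auto
  ultimately show ?thesis by simp
qed

lemma total_recursive_diff [recs]:
  assumes "total_recursive n f" "total_recursive n g"
  shows "total_recursive n (\<lambda>xs. f xs - g xs)"
proof -
  have "total_recursive n (\<lambda>xs. rec_nat (f xs) (\<lambda>k r. r - 1) (g xs))"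
    using assms by (intro total_recursive_rec_nat total_recursive_pred recs) auto
  moreover have "rec_nat a (\<lambda>k r. r - 1) b = a - b" for a b :: nat by (induction b) auto
  ultimately show ?thesis by simp
qed

text \<open>
  A primitive recursion that ignores its previous value distinguishes zero from nonzero, and two
  numbers are equal iff both truncated differences vanish.
\<close>

lemma total_recursive_if_eq [recs]:
  assumes "total_recursive n f" "total_recursive n g" "total_recursive n a" "total_recursive n b"
  shows "total_recursive n (\<lambda>xs. if f xs = g xs then a xs else b xs)"
proof -
  have "total_recursive n (\<lambda>xs. rec_nat (a xs) (\<lambda>k r. b xs) ((f xs - g xs) + (g xs - f xs)))"
    using assms by (intro total_recursive_rec_nat recs total_recursive_tail2)
  moreover have "rec_nat (a xs) (\<lambda>k r. b xs) ((f xs - g xs) + (g xs - f xs)) =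
    (if f xs = g xs then a xs else b xs)" for xs
    by (cases "(f xs - g xs) + (g xs - f xs)") auto
  ultimately show ?thesis by simp
qed

lemma total_recursive_triangle:
  assumes "total_recursive n f"
  shows "total_recursive n (\<lambda>xs. triangle (f xs))"
proof -
  have "total_recursive n (\<lambda>xs. rec_nat 0 (\<lambda>k r. r + Suc k) (f xs))"
    using assms by (intro total_recursive_rec_nat recs) auto
  moreover have "rec_nat 0 (\<lambda>k r. r + Suc k) a = triangle a" for a by (induction a) auto
  ultimately show ?thesis by simp
qed

lemma total_recursive_prod_encode [recs]:
  assumes "total_recursive n f" "total_recursive n g"
  shows "total_recursive n (\<lambda>xs. prod_encode (f xs, g xs))"
  unfolding prod_encode_def using assms by (auto intro!: recs total_recursive_triangle)

text \<open>
  A pair \<open>(a, b)\<close> has the code \<open>triangle (a + b) + a\<close>. Since \<open>a\<close> is at most \<open>a + b\<close>, the sum is found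
  by minimisation, and then \<open>a\<close> and \<open>b\<close> by subtraction.
\<close>

definition triangle_root :: "nat \<Rightarrow> nat" where
  "triangle_root n = (LEAST t. Suc n - triangle (Suc t) = 0)"

lemma triangle_root_prod_encode: "triangle_root (prod_encode (a, b)) = a + b"
proof -
  have mono: "triangle s \<le> triangle t" if "s \<le> t" for s t
    using that by (induction t) (auto simp: le_Suc_eq)
  show ?thesis
    unfolding triangle_root_def
  proof (rule Least_equality)
    show "Suc (prod_encode (a, b)) - triangle (Suc (a + b)) = 0"
      by (simp add: prod_encode_def)
    fix t assume "Suc (prod_encode (a, b)) - triangle (Suc t) = 0"
    then have "triangle (a + b) < triangle (Suc t)" by (simp add: prod_encode_def)
    then show "a + b \<le> t" using mono[of "Suc t" "a + b"] by (metis leD not_less_eq_eq)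
  qed
qed

lemma prod_decode_triangle_root:
  "fst (prod_decode n) = n - triangle (triangle_root n)"
  "snd (prod_decode n) = triangle_root n - fst (prod_decode n)"
proof -
  obtain a b where ab: "prod_decode n = (a, b)" by fastforce
  then have n: "n = prod_encode (a, b)" by (metis prod_decode_inverse)
  show "fst (prod_decode n) = n - triangle (triangle_root n)"
    unfolding n triangle_root_prod_encode by simp (simp add: prod_encode_def)
  show "snd (prod_decode n) = triangle_root n - fst (prod_decode n)"
    unfolding n triangle_root_prod_encode by simp
qed

lemma total_recursive_triangle_root:
  assumes "total_recursive n f"
  shows "total_recursive n (\<lambda>xs. triangle_root (f xs))"
proof (rule total_recursive_comp1[OF _ assms])
  show "total_recursive 1 (\<lambda>ys. triangle_root (ys ! 0))"
    unfolding triangle_root_def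
  proof (rule total_recursive_Least)
    have "total_recursive (Suc 1) (\<lambda>ys. Suc (ys ! 1) - triangle (Suc (ys ! 0)))"
      by (intro recs total_recursive_triangle) auto
    then show "total_recursive (Suc 1) (\<lambda>ys. Suc (tl ys ! 0) - triangle (Suc (ys ! 0)))"
      by (rule total_recursive_cong) (simp add: nth_tl)
    show "\<exists>y. Suc (xs ! 0) - triangle (Suc y) = 0" for xs :: "nat list"
      by (intro exI[of _ "xs ! 0"]) simp
  qed
qed

definition pfst :: "nat \<Rightarrow> nat" where "pfst n = fst (prod_decode n)"
definition psnd :: "nat \<Rightarrow> nat" where "psnd n = snd (prod_decode n)"

lemma pfst_prod_encode [simp]: "pfst (prod_encode (a, b)) = a"
  and psnd_prod_encode [simp]: "psnd (prod_encode (a, b)) = b"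
  by (simp_all add: pfst_def psnd_def)

lemma total_recursive_pfst [recs]:
  assumes "total_recursive n f" shows "total_recursive n (\<lambda>xs. pfst (f xs))"
  unfolding pfst_def prod_decode_triangle_root
  by (intro recs total_recursive_triangle total_recursive_triangle_root assms)

lemma total_recursive_psnd [recs]:
  assumes "total_recursive n f" shows "total_recursive n (\<lambda>xs. psnd (f xs))"
  unfolding psnd_def prod_decode_triangle_root
  by (intro recs total_recursive_triangle total_recursive_triangle_root assms)

text \<open>
  Head and tail on the numbers that code lists; the code of \<open>[]\<close> is sent to \<open>0\<close> by both, in
  agreement with \<open>tape_hd\<close> and \<open>tl\<close>.
\<close>

definition code_hd :: "nat \<Rightarrow> nat" where "code_hd n = pfst (n - 1)"
definition code_tl :: "nat \<Rightarrow> nat" where "code_tl n = psnd (n - 1)"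

lemma code_hd_Cons [simp]: "code_hd (Suc (prod_encode (a, b))) = a"
  and code_tl_Cons [simp]: "code_tl (Suc (prod_encode (a, b))) = b"
  by (simp_all add: code_hd_def code_tl_def)

lemma code_hd_0 [simp]: "code_hd 0 = 0" and code_tl_0 [simp]: "code_tl 0 = 0"
proof -
  have "prod_encode (0, 0) = 0" by (simp add: prod_encode_def)
  then have "prod_decode 0 = (0, 0)" by (metis prod_encode_inverse)
  then show "code_hd 0 = 0" "code_tl 0 = 0" by (simp_all add: code_hd_def code_tl_def pfst_def psnd_def)
qed

lemma code_hd_list_encode: "code_hd (list_encode xs) = tape_hd xs"
  and code_tl_list_encode: "code_tl (list_encode xs) = list_encode (tl xs)"
  by (cases xs; simp)+

lemma total_recursive_code_hd [recs]:
  assumes "total_recursive n f" shows "total_recursive n (\<lambda>xs. code_hd (f xs))"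
  unfolding code_hd_def by (intro recs assms)

lemma total_recursive_code_tl [recs]:
  assumes "total_recursive n f" shows "total_recursive n (\<lambda>xs. code_tl (f xs))"
  unfolding code_tl_def by (intro recs assms)

lemma length_le_list_encode: "length xs \<le> list_encode xs"
proof (induction xs)
  case (Cons a xs)
  have "list_encode xs \<le> prod_encode (a, list_encode xs)" by (rule le_prod_encode_2)
  with Cons show ?case by simp
qed simp

text \<open>
  A fold is the iteration of a map on pairs of a remaining list and an accumulator. It is stationary
  once the list is empty, and the code of a list is at least its length, so the code itself serves as
  the number of iterations. The argument \<open>p\<close> passes parameters to the folded function.
\<close>

lemma total_recursive_foldl:
  assumes f: "total_recursive 3 (\<lambda>ys. f (ys ! 0) (ys ! 1) (ys ! 2))"
    and p: "total_recursive n p" and a: "total_recursive n a" and c: "total_recursive n c"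
  shows "total_recursive n (\<lambda>xs. foldl (f (p xs)) (a xs) (list_decode (c xs)))"
proof -
  define stp where "stp p st = (if pfst st = 0 then st
     else prod_encode (code_tl (pfst st), f p (psnd st) (code_hd (pfst st))))" for p st
  have iter: "((stp p) ^^ m) (prod_encode (list_encode us, b)) = prod_encode (0, foldl (f p) b us)"
    if "length us \<le> m" for p m us b
    using that
  proof (induction m arbitrary: us b)
    case (Suc m)
    show ?case
    proof (cases us)
      case Nil
      then show ?thesis using Suc.IH[of "[]" b] by (simp add: stp_def funpow_Suc_right del: funpow.simps)
    next
      case (Cons u us')
      then show ?thesis using Suc.IH[of us' "f p b u"] Suc.prems
        by (simp add: stp_def funpow_Suc_right del: funpow.simps)
    qed
  qed simp
  have fold: "foldl (f (p xs)) (a xs) (list_decode (c xs)) =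
    psnd (rec_nat (prod_encode (c xs, a xs)) (\<lambda>k r. stp (p xs) r) (c xs))" for xs
  proof -
    have "rec_nat x (\<lambda>k r. h r) m = (h ^^ m) x" for x m and h :: "nat \<Rightarrow> nat"
      by (induction m) auto
    then show ?thesis
      using iter[of "list_decode (c xs)" "c xs" "p xs" "a xs"]
        length_le_list_encode[of "list_decode (c xs)"] by simp
  qed
  show ?thesis
    unfolding fold stp_def
    by (intro recs total_recursive_rec_nat total_recursive_tail2 p a c total_recursive_comp3[OF f]) auto
qed

lemma total_recursive_length_code [recs]:
  assumes "total_recursive n f" shows "total_recursive n (\<lambda>xs. length (list_decode (f xs)))"
proof -
  have "total_recursive n (\<lambda>xs. foldl (\<lambda>b a. Suc b) 0 (list_decode (f xs)))"
    by (rule total_recursive_foldl[where f = "\<lambda>p b a. Suc b" and p = "\<lambda>xs. 0"])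
      (intro recs assms; simp)+
  moreover have "foldl (\<lambda>b a. Suc b) k us = k + length us" for k and us :: "nat list"
    by (induction us arbitrary: k) auto
  ultimately show ?thesis by simp
qed

lemma total_recursive_append_code:
  assumes "total_recursive n f" shows "total_recursive n (\<lambda>xs. list_encode (us @ list_decode (f xs)))"
proof (induction us)
  case Nil
  then show ?case using assms by simp
next
  case (Cons u us)
  then show ?case by (simp, intro recs)
qed

lemma total_recursive_rev_code [recs]:
  assumes "total_recursive n f" shows "total_recursive n (\<lambda>xs. list_encode (rev (list_decode (f xs))))"
proof -
  have "total_recursive n (\<lambda>xs. foldl (\<lambda>b a. Suc (prod_encode (a, b))) 0 (list_decode (f xs)))"
    by (rule total_recursive_foldl[where f = "\<lambda>p b a. Suc (prod_encode (a, b))" and p = "\<lambda>xs. 0"])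
      (intro recs assms; simp)+
  moreover have "foldl (\<lambda>b a. Suc (prod_encode (a, b))) (list_encode vs) us = list_encode (rev us @ vs)" for us vs
    by (induction us arbitrary: vs) (auto simp flip: list_encode.simps)
  from this[of "[]"] have "foldl (\<lambda>b a. Suc (prod_encode (a, b))) 0 us = list_encode (rev us)" for us
    by simp
  ultimately show ?thesis by simp
qed

lemma computable_onI:
  assumes "total_recursive 1 (\<lambda>xs. f (xs ! 0))" "\<And>x. x \<in> A \<Longrightarrow> f (code_in x) = code_out (g x)"
  shows "computable_on code_in code_out A g"
proof -
  obtain h where "recursive 1 h" "\<And>xs. length xs = 1 \<Longrightarrow> h xs = f (xs ! 0)"
    using assms(1) unfolding total_recursive_def by blast
  then show ?thesis unfolding computable_on_def using assms(2)
    by (intro exI[of _ h]) simp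
qed


section \<open>Runs of deterministic systems\<close>

definition runs :: "('a \<Rightarrow> 'a option) \<Rightarrow> 'a \<Rightarrow> 'a \<Rightarrow> bool" where
  "runs f a b \<longleftrightarrow> (\<lambda>x y. f x = Some y)\<^sup>*\<^sup>* a b \<and> f b = None"

lemma runs_step: "runs f a c \<Longrightarrow> f a = Some b \<Longrightarrow> runs f b c"
  unfolding runs_def by (auto elim: converse_rtranclpE)

lemma runs_strip:
  assumes "(\<lambda>x y. f x = Some y)\<^sup>*\<^sup>* a b" "runs f a c" shows "runs f b c"
  using assms by (induction rule: rtranclp_induct) (auto intro: runs_step)

lemma runs_unique:
  assumes "runs f a b" "runs f a c" shows "b = c"
proof -
  have "runs f b c" using assms runs_strip unfolding runs_def[of f a b] by fast
  then show ?thesis using assms(1) by (auto simp: runs_def elim: converse_rtranclpE)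
qed

lemma runs_prepend:
  assumes "(\<lambda>x y. f x = Some y)\<^sup>*\<^sup>* a b" "runs f b c" shows "runs f a c"
  using assms unfolding runs_def by (meson rtranclp_trans)

text \<open>
  The converse direction uses that \<open>g\<close> is deterministic: along a halting run of \<open>g\<close> there is always a
  later configuration that simulates one of \<open>f\<close>, and since every step of \<open>f\<close> costs \<open>g\<close> at least one
  step, the run of \<open>f\<close> cannot outlast that of \<open>g\<close>.
\<close>

lemma runs_simulation:
  assumes step: "\<And>a a' b. Sim a b \<Longrightarrow> f a = Some a' \<Longrightarrow> \<exists>b'. (\<lambda>x y. g x = Some y)\<^sup>+\<^sup>+ b b' \<and> Sim a' b'"
    and halt: "\<And>a b. Sim a b \<Longrightarrow> f a = None \<Longrightarrow> \<exists>b'. runs g b b' \<and> Q a b'"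
    and start: "Sim a b"
  shows "runs f a a' \<Longrightarrow> \<exists>b'. runs g b b' \<and> Q a' b'"
    and "runs g b b' \<Longrightarrow> \<exists>a'. runs f a a' \<and> Q a' b'"
proof -
  assume "runs f a a'"
  then have "(\<lambda>x y. f x = Some y)\<^sup>*\<^sup>* a a'" "f a' = None" by (auto simp: runs_def)
  then show "\<exists>b'. runs g b b' \<and> Q a' b'" using start
  proof (induction arbitrary: b rule: converse_rtranclp_induct)
    case base
    then show ?case using halt by blast
  next
    case (step x y)
    then obtain b1 where "(\<lambda>x y. g x = Some y)\<^sup>+\<^sup>+ b b1" "Sim y b1"
      using assms(1) by blast
    then show ?case using step.IH[OF step.prems(1)] runs_prepend
      by (metis tranclp_into_rtranclp)
  qed
next
  assume "runs g b b'"
  then have "(\<lambda>x y. g x = Some y)\<^sup>*\<^sup>* b b'" "g b' = None" by (auto simp: runs_def)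
  then have "\<exists>a'. runs f a a' \<and> Q a' b'"
    if "(\<lambda>x y. g x = Some y)\<^sup>*\<^sup>* b c" "Sim a c" for a c
    using that
  proof (induction arbitrary: a c rule: converse_rtranclp_induct)
    case base
    then have "c = b'" by (auto elim: converse_rtranclpE)
    then have "f a = None"
      using base step[of a b'] by (cases "f a") (auto dest: tranclpD)
    moreover obtain d where "runs g b' d" "Q a d" using halt base \<open>c = b'\<close> \<open>f a = None\<close> by blast
    moreover have "d = b'" using \<open>runs g b' d\<close> base by (auto simp: runs_def elim: converse_rtranclpE)
    ultimately show ?case by (auto simp: runs_def)
  next
    case (step x y)
    show ?case
    proof (cases "x = c")
      case False
      then have "(\<lambda>x y. g x = Some y)\<^sup>*\<^sup>* y c"
        using step.prems(2) step.hyps(1) by (auto elim: converse_rtranclpE)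
      then show ?thesis using step.IH step.prems by blast
    next
      case True
      show ?thesis
      proof (cases "f a")
        case None
        then obtain d where d: "runs g x d" "Q a d" using halt step.prems(3) True by blast
        have "runs g x b'" using step unfolding runs_def
          by (simp add: converse_rtranclp_into_rtranclp)
        then have "d = b'" using d(1) runs_unique by metis
        then show ?thesis using d None unfolding runs_def by blast
      next
        case (Some a1)
        then obtain e where e: "(\<lambda>x y. g x = Some y)\<^sup>+\<^sup>+ x e" "Sim a1 e"
          using assms(1) step.prems(3) True by blast
        then have "(\<lambda>x y. g x = Some y)\<^sup>*\<^sup>* y e"
          using step.hyps(1) by (auto dest: tranclpD)
        then obtain a' where a': "runs f a1 a'" "Q a' b'"
          using step.IH step.prems(1) e(2) by blast
        have "runs f a a'"
          by (rule runs_prepend[OF _ a'(1)]) (simp add: Some r_into_rtranclp)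
        then show ?thesis using a'(2) by blast
      qed
    qed
  qed
  then show "\<exists>a'. runs f a a' \<and> Q a' b'" using start by blast
qed

section \<open>Recursive functions as loop programs\<close>

text \<open>
  \<open>Loop r c\<close> decrements \<open>r\<close> before each execution of \<open>c\<close>, which may change \<open>r\<close> again, and stops when \<open>r\<close>
  is zero. Test and decrement form a single instruction because counter programs have only this
  one.
\<close>

datatype com = INC nat | DEC nat | Seq com com (infixr \<open>;;\<close> 60) | Loop nat com

inductive big_step :: "com \<Rightarrow> (nat \<Rightarrow> nat) \<Rightarrow> (nat \<Rightarrow> nat) \<Rightarrow> bool" where
  INC: "t = s(r := Suc (s r)) \<Longrightarrow> big_step (INC r) s t"
| DEC: "t = s(r := s r - 1) \<Longrightarrow> big_step (DEC r) s t"
| Seq: "big_step c1 s t \<Longrightarrow> big_step c2 t u \<Longrightarrow> big_step (c1 ;; c2) s u"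
| Loop0: "s r = 0 \<Longrightarrow> big_step (Loop r c) s s"
| LoopSuc: "s r = Suc n \<Longrightarrow> big_step c (s(r := n)) t \<Longrightarrow> big_step (Loop r c) t u \<Longrightarrow>
    big_step (Loop r c) s u"

lemma big_step_eq: "big_step c s t \<Longrightarrow> t = u \<Longrightarrow> big_step c s u" by simp

text \<open>
  There is no empty program; decrementing a counter that holds zero takes its place.
\<close>

lemma big_step_nop: "s r = 0 \<Longrightarrow> big_step (DEC r) s s"
  by (rule DEC) (auto simp: fun_eq_iff)

lemma big_step_clear: "big_step (Loop r (DEC r)) s (s(r := 0))"
proof (induction "s r" arbitrary: s rule: less_induct)
  case less
  show ?case
  proof (cases "s r")
    case 0
    then have "s(r := 0) = s" by auto
    then show ?thesis using big_step_eq[OF Loop0] 0 by metis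
  next
    case (Suc n)
    have "big_step (Loop r (DEC r)) (s(r := n - 1)) ((s(r := n - 1))(r := 0))"
      by (rule less) (use Suc in auto)
    from big_step_eq[OF LoopSuc[where s = s and r = r, OF Suc DEC this]]
    show ?thesis by simp
  qed
qed

lemma big_step_move:
  assumes "a \<noteq> b" shows "big_step (Loop a (INC b)) s (s(a := 0, b := s b + s a))"
proof (induction "s a" arbitrary: s)
  case 0
  then have "s(a := 0, b := s b + s a) = s" by (auto simp: fun_eq_iff)
  then show ?case using big_step_eq[OF Loop0] 0 by metis
next
  case (Suc n)
  have "big_step (Loop a (INC b)) (s(a := n, b := Suc (s b)))
    ((s(a := n, b := Suc (s b)))(a := 0, b := Suc (s b) + n))"
    using Suc(1)[of "s(a := n, b := Suc (s b))"] assms by simp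
  from LoopSuc[where s = s and r = a, OF Suc(2)[symmetric] INC this]
  show ?case
    by (rule big_step_eq) (use Suc(2)[symmetric] assms in \<open>auto simp: fun_eq_iff\<close>)
qed

lemma big_step_move2:
  assumes "a \<noteq> b" "a \<noteq> c" "b \<noteq> c"
  shows "big_step (Loop a (INC b ;; INC c)) s (s(a := 0, b := s b + s a, c := s c + s a))"
proof (induction "s a" arbitrary: s)
  case 0
  then have "s(a := 0, b := s b + s a, c := s c + s a) = s" by (auto simp: fun_eq_iff)
  then show ?case using big_step_eq[OF Loop0] 0 by metis
next
  case (Suc n)
  let ?t = "s(a := n, b := Suc (s b), c := Suc (s c))"
  have 1: "big_step (Loop a (INC b ;; INC c)) ?t (?t(a := 0, b := Suc (s b) + n, c := Suc (s c) + n))"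
    using Suc(1)[of ?t] assms by simp
  have 2: "big_step (INC b ;; INC c) (s(a := n)) ?t"
    by (rule Seq[OF INC[OF refl] INC]) (use assms in auto)
  from LoopSuc[where s = s and r = a, OF Suc(2)[symmetric] 2 1]
  show ?case
    by (rule big_step_eq) (use Suc(2)[symmetric] assms in \<open>auto simp: fun_eq_iff\<close>)
qed

definition copy :: "nat \<Rightarrow> nat \<Rightarrow> nat \<Rightarrow> com" where
  "copy a b t = Loop a (INC b ;; INC t) ;; Loop t (INC a)"

lemma big_step_copy:
  assumes "a \<noteq> b" "a \<noteq> t" "b \<noteq> t" "s b = 0" "s t = 0"
  shows "big_step (copy a b t) s (s(b := s a))"
  unfolding copy_def
  by (rule Seq[OF big_step_move2[OF assms(1-3)]], rule big_step_eq, rule big_step_move) (use assms in \<open>auto simp: fun_eq_iff\<close>)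

text \<open>
  The rule for loops that count down: the states \<open>S k\<close> are those before the loop test, after \<open>k\<close>
  executions of the body.
\<close>

lemma big_step_Loop_iterate:
  assumes body: "\<And>k. k < n \<Longrightarrow> big_step c ((S k)(r := n - Suc k)) (S (Suc k))"
    and r: "\<And>k. k \<le> n \<Longrightarrow> S k r = n - k"
  shows "big_step (Loop r c) (S 0) (S n)"
proof -
  have "big_step (Loop r c) (S (n - j)) (S n)" if "j \<le> n" for j
    using that
  proof (induction j)
    case 0
    then show ?case using r[of n] by (auto intro: Loop0)
  next
    case (Suc j)
    then have "n - j = Suc (n - Suc j)" by simp
    with Suc have "big_step c ((S (n - Suc j))(r := j)) (S (n - j))"
      using body[of "n - Suc j"] by simp
    moreover have "S (n - Suc j) r = Suc j" using r[of "n - Suc j"] Suc by simp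
    ultimately show ?case using Suc by (meson LoopSuc Suc_leD)
  qed
  from this[of n] show ?thesis by simp
qed

text \<open>
  The arguments lie in the counters \<open>as\<close>, below \<open>d\<close>; the counters from \<open>d\<close> on are workspace, which must
  be zero at the start and is zero again at the end, except for the result in \<open>d\<close>. Such programs can
  be nested without any bookkeeping of used counters.
\<close>

definition loop_computes :: "com \<Rightarrow> nat list \<Rightarrow> nat \<Rightarrow> (nat list \<Rightarrow> nat) \<Rightarrow> bool" where
  "loop_computes c as d f \<longleftrightarrow>
     (\<forall>s. (\<forall>r\<ge>d. s r = 0) \<longrightarrow> big_step c s (s(d := f (map s as))))"

definition store :: "nat \<Rightarrow> nat list \<Rightarrow> (nat \<Rightarrow> nat) \<Rightarrow> nat \<Rightarrow> nat" where
  "store d ys s = (\<lambda>r. if d \<le> r \<and> r < d + length ys then ys ! (r - d) else s r)"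

lemma store_Nil: "store d [] s = s"
  by (auto simp: store_def)

lemma store_Cons: "store d (y # ys) s = store (Suc d) ys (s(d := y))"
  by (auto simp: store_def fun_eq_iff nth_Cons' not_less_eq_eq Suc_diff_le)

lemma loop_computes_list:
  assumes "\<And>g d. g \<in> set gs \<Longrightarrow> \<forall>a\<in>set as. a < d \<Longrightarrow> \<exists>c. loop_computes c as d g" "\<forall>a\<in>set as. a < d"
  shows "\<exists>c. \<forall>s. (\<forall>r\<ge>d. s r = 0) \<longrightarrow> big_step c s (store d (map (\<lambda>g. g (map s as)) gs) s)"
  using assms
proof (induction gs arbitrary: d)
  case Nil
  then show ?case using big_step_nop by (intro exI[of _ "DEC d"]) (simp add: store_Nil)
next
  case (Cons g gs)
  obtain c where c: "loop_computes c as d g" using Cons.prems by fastforce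
  have lt: "\<forall>a\<in>set as. a < Suc d" using Cons.prems(2) by auto
  have "\<exists>c. \<forall>s. (\<forall>r\<ge>Suc d. s r = 0) \<longrightarrow> big_step c s (store (Suc d) (map (\<lambda>g. g (map s as)) gs) s)"
    by (rule Cons.IH[OF Cons.prems(1) lt]) auto
  then obtain e where e: "\<And>s. \<forall>r\<ge>Suc d. s r = 0 \<Longrightarrow>
    big_step e s (store (Suc d) (map (\<lambda>g. g (map s as)) gs) s)"
    by blast
  show ?case
  proof (intro exI[of _ "c ;; e"] allI impI)
    fix s :: "nat \<Rightarrow> nat" assume s: "\<forall>r\<ge>d. s r = 0"
    let ?s = "s(d := g (map s as))"
    have m: "map ?s as = map s as" using Cons.prems(2) by auto
    have "big_step c s ?s" using c s by (auto simp: loop_computes_def)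
    moreover have "big_step e ?s (store (Suc d) (map (\<lambda>g. g (map ?s as)) gs) ?s)"
      by (rule e) (use s in auto)
    ultimately show "big_step (c ;; e) s (store d (map (\<lambda>g. g (map s as)) (g # gs)) s)"
      unfolding m list.map store_Cons by (rule Seq)
  qed
qed

lemma clear_range: "\<exists>c. \<forall>s. s t = 0 \<longrightarrow> big_step c s (\<lambda>r. if d \<le> r \<and> r < d + m then 0 else s r)"
proof (induction m)
  case 0
  have "(\<lambda>r. if d \<le> r \<and> r < d + 0 then 0 else s r) = s" for s :: "nat \<Rightarrow> nat"
    by (auto simp: fun_eq_iff)
  then show ?case using big_step_nop by (intro exI[of _ "DEC t"]) simp
next
  case (Suc m)
  then obtain c where c: "\<And>s. s t = 0 \<Longrightarrow> big_step c s (\<lambda>r. if d \<le> r \<and> r < d + m then 0 else s r)" by blast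
  show ?case
    by (intro exI[of _ "c ;; Loop (d + m) (DEC (d + m))"] allI impI)
      (rule big_step_eq[OF Seq[OF c big_step_clear]], auto simp: fun_eq_iff)
qed

text \<open>
  Induction on the construction of \<open>f\<close>. A composition evaluates the inner functions side by side
  above the result, a primitive recursion is a loop that counts down a copy of the recursion argument
  while the index counts up, and a minimisation is a loop controlled by the value of \<open>f\<close> at the current
  candidate.
\<close>

theorem recursive_imp_loop_computes:
  assumes "recursive n f" "length as = n" "\<forall>a\<in>set as. a < d"
  shows "\<exists>c. loop_computes c as d f"
  using assms
proof (induction arbitrary: as d rule: recursive.induct)
  case (zero n)
  have "s(d := 0) = s" if "s d = 0" for s :: "nat \<Rightarrow> nat" using that by auto
  then show ?case
    by (intro exI[of _ "DEC d"]) (auto simp: loop_computes_def intro!: big_step_nop)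
next
  case succ
  then obtain a where as: "as = [a]" "a < d" by (cases as) auto
  show ?case
    unfolding loop_computes_def
    by (intro exI[of _ "copy a d (Suc d) ;; INC d"] allI impI Seq[OF big_step_copy INC]) (use as in auto)
next
  case (proj i n)
  then have a: "as ! i < d" by auto
  have "big_step (copy (as ! i) d (Suc d)) s (s(d := s (as ! i)))" if "\<forall>r\<ge>d. s r = 0" for s
    by (rule big_step_copy) (use a that in auto)
  then show ?case using proj
    by (intro exI[of _ "copy (as ! i) d (Suc d)"]) (auto simp: loop_computes_def)
next
  case (comp gs f n)
  let ?m = "length gs" and ?d = "Suc d"
  have lt: "\<forall>a\<in>set as. a < Suc d" using comp.prems by auto
  obtain c where c: "\<And>s. \<forall>r\<ge>?d. s r = 0 \<Longrightarrow>
    big_step c s (store ?d (map (\<lambda>g. g (map s as)) gs) s)"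
    using loop_computes_list[of gs as ?d] comp lt by blast
  obtain e where e: "loop_computes e [?d..<?d + ?m] (?d + ?m) f"
    using comp.IH(1)[of "[?d..<?d + ?m]" "?d + ?m"] by (simp del: upt_Suc) blast
  obtain w where w: "\<And>s. s (?d + ?m) = 0 \<Longrightarrow>
      big_step w s (\<lambda>r. if ?d \<le> r \<and> r < ?d + ?m then 0 else s r)"
    using clear_range by blast
  show ?case
    unfolding loop_computes_def
  proof (intro exI[of _ "c ;; e ;; Loop (?d + ?m) (INC d) ;; w"] allI impI)
    fix s :: "nat \<Rightarrow> nat" assume s: "\<forall>r\<ge>d. s r = 0"
    define y where "y = f (map (\<lambda>g. g (map s as)) gs)"
    define s1 where "s1 = store ?d (map (\<lambda>g. g (map s as)) gs) s"
    have "map s1 [?d..<?d + ?m] = map (\<lambda>g. g (map s as)) gs"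
      by (rule nth_equalityI) (auto simp: s1_def store_def simp del: upt_Suc)
    moreover have "\<forall>r\<ge>?d + ?m. s1 r = 0" using s by (auto simp: s1_def store_def)
    ultimately have 2: "big_step e s1 (s1(?d + ?m := y))"
      using e unfolding loop_computes_def y_def by metis
    have 3: "big_step (Loop (?d + ?m) (INC d)) (s1(?d + ?m := y)) (s1(d := y))"
      by (rule big_step_eq[OF big_step_move]) (use s in \<open>auto simp: s1_def store_def fun_eq_iff\<close>)
    have 4: "big_step w (s1(d := y)) (s(d := y))"
      by (rule big_step_eq[OF w]) (use s in \<open>auto simp: s1_def store_def fun_eq_iff\<close>)
    show "big_step (c ;; e ;; Loop (?d + ?m) (INC d) ;; w) s (s(d := f (map (\<lambda>g. g (map s as)) gs)))"
      unfolding y_def[symmetric]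
      by (rule Seq[OF _ Seq[OF 2 Seq[OF 3 4]]]) (use s in \<open>auto simp: s1_def intro!: c\<close>)
  qed
next
  case (prim n f g)
  then obtain a as' where as: "as = a # as'" by (cases as) auto
  have len: "length as' = n" and lt: "a < d" "\<forall>b\<in>set as'. b < d" using prim.prems as by auto
  have lt3: "\<forall>b\<in>set (Suc (Suc d) # d # as'). b < d + 3" using lt by auto
  obtain c where c: "loop_computes c as' d f" using prim.IH(1) len lt by blast
  obtain e where e: "loop_computes e (Suc (Suc d) # d # as') (d + 3) g"
    using prim.IH(2)[OF _ lt3] len by auto
  let ?body = "e ;; Loop d (DEC d) ;; Loop (d + 3) (INC d) ;; INC (Suc (Suc d))"
  show ?case
    unfolding loop_computes_def
  proof (intro exI[of _ "c ;; copy a (Suc d) (Suc (Suc d)) ;; Loop (Suc d) ?body ;;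
      Loop (Suc (Suc d)) (DEC (Suc (Suc d)))"] allI impI)
    fix s :: "nat \<Rightarrow> nat" assume s: "\<forall>r\<ge>d. s r = 0"
    define xs where "xs = map s as'"
    define h where "h k = rec_nat (f xs) (\<lambda>k r. g (k # r # xs)) k" for k
    define S where "S k = s(d := h k, Suc d := s a - k, Suc (Suc d) := k)" for k
    have mapS: "map (t(u := x)) as' = map t as'" if "d \<le> u" for t :: "nat \<Rightarrow> nat" and u x
      using that lt by auto
    have map': "map s as' = xs" by (simp add: xs_def)
    have 1: "big_step c s (s(d := h 0))"
      using c s by (simp add: loop_computes_def h_def xs_def)
    have 2: "big_step (copy a (Suc d) (Suc (Suc d))) (s(d := h 0)) (S 0)"
      by (rule big_step_eq[OF big_step_copy]) (use lt s in \<open>auto simp: S_def fun_eq_iff\<close>)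
    have 3: "big_step (Loop (Suc d) ?body) (S 0) (S (s a))"
    proof (rule big_step_Loop_iterate)
      fix k assume k: "k < s a"
      let ?t = "(S k)(Suc d := s a - Suc k)"
      have "big_step e ?t (?t(d + 3 := h (Suc k)))"
      proof -
        have "map ?t (Suc (Suc d) # d # as') = k # h k # xs"
          using map' by (simp add: S_def mapS)
        moreover have "g (k # h k # xs) = h (Suc k)" by (simp add: h_def)
        moreover have "\<forall>r\<ge>d + 3. ?t r = 0" using s by (auto simp: S_def)
        ultimately show ?thesis using e unfolding loop_computes_def by metis
      qed
      then show "big_step ?body ?t (S (Suc k))"
        by (rule Seq[OF _ Seq[OF big_step_clear Seq[OF big_step_move INC]]]) (use s in \<open>auto simp: S_def fun_eq_iff\<close>)
    qed (auto simp: S_def)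
    have 4: "big_step (Loop (Suc (Suc d)) (DEC (Suc (Suc d)))) (S (s a)) (s(d := h (s a)))"
      by (rule big_step_eq[OF big_step_clear]) (use s in \<open>auto simp: S_def fun_eq_iff\<close>)
    show "big_step (c ;; copy a (Suc d) (Suc (Suc d)) ;; Loop (Suc d) ?body ;;
        Loop (Suc (Suc d)) (DEC (Suc (Suc d)))) s
       (s(d := rec_nat (f (tl (map s as))) (\<lambda>k r. g (k # r # tl (map s as))) (hd (map s as))))"
      using Seq[OF 1 Seq[OF 2 Seq[OF 3 4]]] by (simp add: as h_def xs_def)
  qed
next
  case (mini n f)
  have lt: "\<forall>b\<in>set (d # as). b < Suc d" using mini.prems by auto
  obtain c where c: "loop_computes c (d # as) (Suc d) f"
    using mini.IH[OF _ lt] mini.prems by auto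
  let ?body = "Loop (Suc d) (DEC (Suc d)) ;; INC d ;; c"
  show ?case
    unfolding loop_computes_def
  proof (intro exI[of _ "c ;; Loop (Suc d) ?body"] allI impI)
    fix s :: "nat \<Rightarrow> nat" assume s: "\<forall>r\<ge>d. s r = 0"
    define xs where "xs = map s as"
    define n where "n = (LEAST y. f (y # xs) = 0)"
    have n0: "f (n # xs) = 0" unfolding n_def
      by (rule LeastI_ex) (use mini in \<open>auto simp: xs_def\<close>)
    have less: "f (y # xs) \<noteq> 0" if "y < n" for y using that not_less_Least n_def by auto
    have m: "map (t(u := x)) as = map t as" if "d \<le> u" for t :: "nat \<Rightarrow> nat" and u x
      using that mini.prems by auto
    have call: "big_step c (s(d := y)) (s(d := y, Suc d := f (y # xs)))" for y
    proof -
      have "map (s(d := y)) (d # as) = y # xs" by (simp add: m xs_def)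
      moreover have "\<forall>r\<ge>Suc d. (s(d := y)) r = 0" using s by auto
      ultimately show ?thesis using c unfolding loop_computes_def by metis
    qed
    have loop: "big_step (Loop (Suc d) ?body) (s(d := y, Suc d := f (y # xs))) (s(d := n))" if "y \<le> n" for y
      using that
    proof (induction "n - y" arbitrary: y)
      case 0
      then have "y = n" by simp
      then show ?case
        by (intro big_step_eq[OF Loop0]) (use n0 s in \<open>auto simp: fun_eq_iff\<close>)
    next
      case (Suc j)
      then have "y < n" by simp
      then obtain z where z: "f (y # xs) = Suc z" using less not0_implies_Suc by blast
      have IH: "big_step (Loop (Suc d) ?body) (s(d := Suc y, Suc d := f (Suc y # xs))) (s(d := n))"
        using Suc by auto
      have body: "big_step ?body (s(d := y, Suc d := z)) (s(d := Suc y, Suc d := f (Suc y # xs)))"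
      proof (rule Seq[OF big_step_clear Seq[OF INC[OF refl]]])
        have "(s(d := y, Suc d := z, Suc d := 0))(d := Suc ((s(d := y, Suc d := z, Suc d := 0)) d)) = s(d := Suc y)"
          using s by (auto simp: fun_eq_iff)
        then show "big_step c ((s(d := y, Suc d := z, Suc d := 0))(d := Suc ((s(d := y, Suc d := z, Suc d := 0)) d)))
          (s(d := Suc y, Suc d := f (Suc y # xs)))" using call by simp
      qed
      have "(s(d := y, Suc d := f (y # xs)))(Suc d := z) = s(d := y, Suc d := z)" by auto
      then show ?case using LoopSuc[OF _ _ IH, where n = z] z body by auto
    qed
    have "s(d := 0) = s" using s by auto
    with call[of 0] have "big_step c s (s(d := 0, Suc d := f (0 # xs)))" by simp
    from Seq[OF this loop[of 0]] show "big_step (c ;; Loop (Suc d) ?body) s (s(d := LEAST y. f (y # map s as) = 0))"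
      by (simp add: n_def xs_def)
  qed
qed

section \<open>Counter programs\<close>

datatype instr = Inc nat nat | Dec nat nat nat

text \<open>
  A program counter outside the program means that the program has halted.
\<close>

fun counter_step :: "instr list \<Rightarrow> nat \<times> (nat \<Rightarrow> nat) \<Rightarrow> (nat \<times> (nat \<Rightarrow> nat)) option" where
  "counter_step P (i, s) = (if i < length P then
     (case P ! i of
        Inc r e \<Rightarrow> Some (e, s(r := Suc (s r)))
      | Dec r e z \<Rightarrow> Some (if s r = 0 then (z, s) else (e, s(r := s r - 1))))
     else None)"

fun com_size :: "com \<Rightarrow> nat" where
  "com_size (INC r) = 1"
| "com_size (DEC r) = 1"
| "com_size (c1 ;; c2) = com_size c1 + com_size c2"
| "com_size (Loop r c) = Suc (com_size c)"

text \<open>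
  The code for \<open>c\<close> is placed at address \<open>a\<close> and continues at \<open>e\<close>. The explicit exit address makes jumps
  superfluous: the body of a loop exits to the head of the loop.
\<close>

fun compile :: "com \<Rightarrow> nat \<Rightarrow> nat \<Rightarrow> instr list" where
  "compile (INC r) a e = [Inc r e]"
| "compile (DEC r) a e = [Dec r e e]"
| "compile (c1 ;; c2) a e = compile c1 a (a + com_size c1) @ compile c2 (a + com_size c1) e"
| "compile (Loop r c) a e = Dec r (Suc a) e # compile c (Suc a) a"

lemma length_compile [simp]: "length (compile c a e) = com_size c"
  by (induction c arbitrary: a e) auto

fun targets :: "instr \<Rightarrow> nat set" where
  "targets (Inc r e) = {e}"
| "targets (Dec r e z) = {e, z}"

fun reg :: "instr \<Rightarrow> nat" where
  "reg (Inc r e) = r"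
| "reg (Dec r e z) = r"

lemma com_size_pos: "com_size c > 0" by (induction c) auto

lemma targets_compile: "i \<in> set (compile c a e) \<Longrightarrow> targets i \<subseteq> insert e {a..<a + com_size c}"
proof (induction c arbitrary: a e)
  case (Seq c1 c2)
  from Seq.prems have "i \<in> set (compile c1 a (a + com_size c1)) \<or> i \<in> set (compile c2 (a + com_size c1) e)"
    by simp
  then show ?case
    using Seq.IH(1)[of a "a + com_size c1"] Seq.IH(2)[of "a + com_size c1" e] com_size_pos[of c2]
    by fastforce
next
  case (Loop r c)
  from Loop.prems have "i = Dec r (Suc a) e \<or> i \<in> set (compile c (Suc a) a)" by simp
  then show ?case using Loop.IH[of "Suc a" a] com_size_pos[of c] by fastforce
qed auto

definition code_at :: "instr list \<Rightarrow> nat \<Rightarrow> instr list \<Rightarrow> bool" where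
  "code_at P a C \<longleftrightarrow> a + length C \<le> length P \<and> (\<forall>i<length C. P ! (a + i) = C ! i)"

lemma code_at_append: "code_at P a (C @ D) \<longleftrightarrow> code_at P a C \<and> code_at P (a + length C) D"
proof
  assume A: "code_at P a (C @ D)"
  have "P ! (a + i) = C ! i" if "i < length C" for i
    using A that by (auto simp: code_at_def nth_append dest!: spec[of _ i])
  moreover have "P ! (a + length C + i) = D ! i" if "i < length D" for i
    using A that by (auto simp: code_at_def nth_append add.assoc dest!: spec[of _ "length C + i"])
  ultimately show "code_at P a C \<and> code_at P (a + length C) D" using A by (auto simp: code_at_def)
next
  assume A: "code_at P a C \<and> code_at P (a + length C) D"
  have "P ! (a + i) = (C @ D) ! i" if "i < length C + length D" for i
    using A that by (cases "i < length C")
      (auto simp: code_at_def nth_append add.assoc dest!: spec[of _ "i - length C"])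
  then show "code_at P a (C @ D)" using A by (auto simp: code_at_def)
qed

lemma code_at_Cons: "code_at P a (i # C) \<longleftrightarrow> a < length P \<and> P ! a = i \<and> code_at P (Suc a) C"
  using code_at_append[of P a "[i]" C] by (auto simp: code_at_def)

abbreviation counter_steps where
  "counter_steps P \<equiv> (\<lambda>x y. counter_step P x = Some y)\<^sup>+\<^sup>+"

lemma compile_correct:
  assumes "big_step c s t" "code_at P a (compile c a e)"
  shows "counter_steps P (a, s) (e, t)"
  using assms
proof (induction arbitrary: a e rule: big_step.induct)
  case (INC t s r)
  then show ?case by (intro tranclp.r_into_trancl) (auto simp: code_at_Cons)
next
  case (DEC t s r)
  then have "t = s" if "s r = 0" using that by (auto simp: fun_eq_iff)
  with DEC show ?case by (intro tranclp.r_into_trancl) (auto simp: code_at_Cons)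
next
  case (Seq c1 s t c2 u)
  then have "code_at P a (compile c1 a (a + com_size c1))"
    "code_at P (a + com_size c1) (compile c2 (a + com_size c1) e)"
    by (simp_all add: code_at_append)
  then show ?case using Seq.IH by (meson tranclp_trans)
next
  case (Loop0 s r c)
  then show ?case by (intro tranclp.r_into_trancl) (auto simp: code_at_Cons)
next
  case (LoopSuc s r n c t u)
  then have code: "code_at P (Suc a) (compile c (Suc a) a)" by (simp add: code_at_Cons)
  have "counter_steps P (a, s) (Suc a, s(r := n))"
    using LoopSuc by (intro tranclp.r_into_trancl) (auto simp: code_at_Cons)
  moreover have "counter_steps P (Suc a, s(r := n)) (a, t)" by (rule LoopSuc.IH(1)[OF code])
  moreover have "counter_steps P (a, t) (e, u)" by (rule LoopSuc.IH(2)[OF LoopSuc.prems])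
  ultimately show ?case by (meson tranclp_trans)
qed

definition input_registers :: "nat \<Rightarrow> nat \<Rightarrow> nat" where
  "input_registers x = (\<lambda>_. 0)(0 := x)"

definition counter_program :: "instr list \<Rightarrow> nat \<Rightarrow> bool" where
  "counter_program P k \<longleftrightarrow> 0 < k \<and> (\<forall>i\<in>set P. reg i < k \<and> targets i \<subseteq> {..length P})"

text \<open>
  \<open>\<Phi>\<close> returns the next value plus one, or zero if there is none.
\<close>

fun orbit :: "(nat \<Rightarrow> nat) \<Rightarrow> nat \<Rightarrow> nat option" where
  "orbit \<Phi> x = (case \<Phi> x of 0 \<Rightarrow> None | Suc y \<Rightarrow> Some y)"

text \<open>
  The program computes \<open>\<Phi> x\<close> into counter 1 and then loops on this counter. The test of the loop
  recognises the end of the orbit, and its decrement turns the successor returned by \<open>\<Phi>\<close> into the next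
  value.
\<close>

theorem orbit_counter_program:
  assumes "total_recursive 1 (\<lambda>xs. \<Phi> (xs ! 0))"
  obtains P k where "counter_program P k"
    "\<And>x y. runs (orbit \<Phi>) x y \<Longrightarrow>
       runs (counter_step P) (0, input_registers x) (length P, input_registers y)"
    "\<And>x b. runs (counter_step P) (0, input_registers x) b \<Longrightarrow> \<exists>y. runs (orbit \<Phi>) x y"
proof -
  obtain f where f: "recursive 1 f" "\<And>xs. length xs = 1 \<Longrightarrow> f xs = \<Phi> (xs ! 0)"
    using assms unfolding total_recursive_def by blast
  obtain c where c: "loop_computes c [0] 1 f"
    using recursive_imp_loop_computes[OF f(1), of "[0]" 1] by auto
  have call: "big_step c (input_registers x) ((input_registers x)(1 := \<Phi> x))" for x
    using c f(2) unfolding loop_computes_def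
    by (auto simp: input_registers_def dest!: spec[of _ "input_registers x"])
  define body where "body = Loop 0 (DEC 0) ;; Loop 1 (INC 0) ;; c"
  define A where "A = com_size c"
  define P where "P = compile (c ;; Loop 1 body) 0 (com_size (c ;; Loop 1 body))"
  define k where "k = Suc (Max (insert 0 (reg ` set P)))"
  have "reg i < k" if "i \<in> set P" for i
    unfolding k_def using that by (auto simp: less_Suc_eq_le)
  moreover have len: "length P = com_size (c ;; Loop 1 body)" by (simp add: P_def)
  moreover have "targets i \<subseteq> {..length P}" if "i \<in> set P" for i
    using targets_compile[OF that[unfolded P_def]] unfolding len by auto
  moreover have "0 < k" by (simp add: k_def)
  ultimately have P: "counter_program P k" by (auto simp: counter_program_def)
  have "code_at P 0 P" by (simp add: code_at_def)
  then have "code_at P 0 (compile (c ;; Loop 1 body) 0 (length P))" by (simp add: P_def)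
  then have code: "code_at P 0 (compile c 0 A)" "A < length P" "P ! A = Dec 1 (Suc A) (length P)"
    "code_at P (Suc A) (compile body (Suc A) A)"
    by (simp_all add: A_def code_at_append code_at_Cons)
  define Sim where "Sim x b \<longleftrightarrow> b = (A, (input_registers x)(1 := \<Phi> x))" for x and b :: "nat \<times> (nat \<Rightarrow> nat)"
  define Q where "Q x b \<longleftrightarrow> b = (length P, input_registers x)" for x and b :: "nat \<times> (nat \<Rightarrow> nat)"
  have start: "counter_steps P (0, input_registers x) (A, (input_registers x)(1 := \<Phi> x))" for x
    by (rule compile_correct[OF call code(1)])
  have step: "\<exists>b'. counter_steps P b b' \<and> Sim y b'" if "Sim x b" "orbit \<Phi> x = Some y" for x y b
  proof -
    have y: "\<Phi> x = Suc y" using that(2) by (auto split: nat.splits)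
    have "big_step body ((input_registers x)(1 := y)) ((input_registers y)(1 := \<Phi> y))"
    proof -
      have "big_step (Loop 1 (INC 0)) ((input_registers x)(1 := y, 0 := 0)) (input_registers y)"
        by (rule big_step_eq[OF big_step_move]) (auto simp: input_registers_def fun_eq_iff)
      then show ?thesis unfolding body_def by (intro Seq[OF big_step_clear Seq[OF _ call]])
    qed
    then have "counter_steps P (Suc A, (input_registers x)(1 := y)) (A, (input_registers y)(1 := \<Phi> y))"
      using code(4) by (rule compile_correct)
    moreover have "counter_step P b = Some (Suc A, (input_registers x)(1 := y))"
      using that(1) code(2,3) y by (simp add: Sim_def)
    ultimately show ?thesis
      unfolding Sim_def by (intro exI[of _ "(A, (input_registers y)(1 := \<Phi> y))"]) (auto intro: tranclp_into_tranclp2)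
  qed
  have halt: "\<exists>b'. runs (counter_step P) b b' \<and> Q x b'" if "Sim x b" "orbit \<Phi> x = None" for x b
  proof -
    have y: "\<Phi> x = 0" using that(2) by (auto split: nat.splits)
    then have "(input_registers x)(1 := \<Phi> x) = input_registers x" by (auto simp: input_registers_def)
    then have "counter_step P b = Some (length P, input_registers x)"
      using that(1) code(2,3) y by (simp add: Sim_def) (simp add: input_registers_def)
    then show ?thesis unfolding Q_def runs_def by auto
  qed
  have Sim0: "Sim x (A, (input_registers x)(1 := \<Phi> x))" for x by (simp add: Sim_def)
  note simulation = runs_simulation[where Sim = Sim and f = "orbit \<Phi>" and g = "counter_step P" and Q = Q]
  show thesis
  proof
    show "counter_program P k" by (rule P)
    show "runs (counter_step P) (0, input_registers x) (length P, input_registers y)"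
      if "runs (orbit \<Phi>) x y" for x y
    proof -
      have "\<exists>b. runs (counter_step P) (A, (input_registers x)(1 := \<Phi> x)) b \<and> Q y b"
        by (rule simulation(1)[OF _ _ Sim0 that]) (fact step halt)+
      then show ?thesis
        using runs_prepend[OF tranclp_into_rtranclp[OF start[of x]]] unfolding Q_def by auto
    qed
    show "\<exists>y. runs (orbit \<Phi>) x y" if "runs (counter_step P) (0, input_registers x) b" for x b
    proof -
      have "\<exists>y. runs (orbit \<Phi>) x y \<and> Q y b"
        by (rule simulation(2)[OF _ _ Sim0 runs_strip[OF tranclp_into_rtranclp[OF start] that]])
          (fact step halt)+
      then show ?thesis by blast
    qed
  qed
qed


section \<open>Turing machine steps on codes\<close>

definition config_code :: "turing_machine \<Rightarrow> tm_config \<Rightarrow> nat" where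
  "config_code M = (\<lambda>(q, l, r). prod_encode (list_encode (map quintuple_code M),
     prod_encode (q, prod_encode (list_encode l, list_encode r))))"

text \<open>
  To be folded over a table: the accumulator is zero until the key is found, and then the successor
  of the right-hand side of the entry, so that the first matching entry wins as in \<open>map_of\<close>.
\<close>

definition match_quintuple :: "nat \<Rightarrow> nat \<Rightarrow> nat \<Rightarrow> nat" where
  "match_quintuple p b e = (if b = 0 then
     (if code_hd e = pfst p then
        (if code_hd (code_tl e) = psnd p then Suc (code_tl (code_tl e)) else 0) else 0) else b)"

lemma foldl_match_quintuple:
  "foldl (match_quintuple (prod_encode (q, a))) 0 (map quintuple_code M) =
    (case map_of M (q, a) of None \<Rightarrow> 0
     | Some (q', b, d) \<Rightarrow> Suc (list_encode [q', b, direction_code d]))"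
proof (induction M)
  case (Cons e M)
  have keep: "foldl (match_quintuple p) (Suc x) es = Suc x" for p x es
    by (induction es) (auto simp: match_quintuple_def)
  obtain q1 a1 q2 b d where e: "e = ((q1, a1), (q2, b, d))" by (metis prod.exhaust)
  have "match_quintuple (prod_encode (q, a)) 0 (quintuple_code e) =
    (if q1 = q \<and> a1 = a then Suc (list_encode [q2, b, direction_code d]) else 0)"
    by (simp add: e match_quintuple_def)
  then show ?case using Cons keep by (simp add: e)
qed simp

definition tm_step_code :: "nat \<Rightarrow> nat" where
  "tm_step_code z =
     (let m = pfst z; q = pfst (psnd z); l = pfst (psnd (psnd z)); r = psnd (psnd (psnd z));
          e = foldl (match_quintuple (prod_encode (q, code_hd r))) 0 (list_decode m);
          q' = code_hd (e - 1); b = code_hd (code_tl (e - 1));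
          d = code_hd (code_tl (code_tl (e - 1)))
      in if e = 0 then 0
         else Suc (prod_encode (m, prod_encode (q',
           if d = 0 then prod_encode (code_tl l, Suc (prod_encode (code_hd l, Suc (prod_encode (b, code_tl r)))))
           else prod_encode (Suc (prod_encode (b, l)), code_tl r)))))"

lemma total_recursive_tm_step_code: "total_recursive 1 (\<lambda>xs. tm_step_code (xs ! 0))"
proof -
  have "total_recursive 3 (\<lambda>ys. match_quintuple (ys ! 0) (ys ! 1) (ys ! 2))"
    unfolding match_quintuple_def by (intro recs) auto
  then show ?thesis
    unfolding tm_step_code_def Let_def by (intro recs total_recursive_foldl) auto
qed

lemma orbit_tm_step_code:
  "orbit tm_step_code (config_code M C) = map_option (config_code M) (tm_step M C)"
proof -
  obtain q l r where C: "C = (q, l, r)" by (metis prod.exhaust)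
  show ?thesis
  proof (cases "map_of M (q, tape_hd r)")
    case None
    then show ?thesis
      by (simp add: C config_code_def tm_step_code_def foldl_match_quintuple code_hd_list_encode)
  next
    case (Some e)
    then obtain q' b d where e: "map_of M (q, tape_hd r) = Some (q', b, d)" by (metis prod.exhaust)
    then show ?thesis
      by (cases d) (simp_all add: C config_code_def tm_step_code_def foldl_match_quintuple
          code_hd_list_encode code_tl_list_encode)
  qed
qed

lemma runs_tm_step_code:
  shows "runs (tm_step M) C D \<Longrightarrow> runs (orbit tm_step_code) (config_code M C) (config_code M D)"
    and "runs (orbit tm_step_code) (config_code M C) y \<Longrightarrow> \<exists>D. runs (tm_step M) C D"
proof -
  note simulation = runs_simulation[where Sim = "\<lambda>C x. x = config_code M C" and f = "tm_step M" and
      g = "orbit tm_step_code" and Q = "\<lambda>C x. x = config_code M C"]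
  have step: "\<exists>b'. (\<lambda>x y. orbit tm_step_code x = Some y)\<^sup>+\<^sup>+ b b' \<and> b' = config_code M D"
    if "b = config_code M C" "tm_step M C = Some D" for C D b
    using orbit_tm_step_code[of M C] that by auto
  have halt: "\<exists>b'. runs (orbit tm_step_code) b b' \<and> b' = config_code M C"
    if "b = config_code M C" "tm_step M C = None" for C b
    using orbit_tm_step_code[of M C] that by (auto simp: runs_def)
  show "runs (orbit tm_step_code) (config_code M C) (config_code M D)" if "runs (tm_step M) C D"
  proof -
    have "\<exists>b. runs (orbit tm_step_code) (config_code M C) b \<and> b = config_code M D"
      by (rule simulation(1)[OF _ _ refl that]) (fact step halt)+
    then show ?thesis by simp
  qed
  show "\<exists>D. runs (tm_step M) C D" if "runs (orbit tm_step_code) (config_code M C) y"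
  proof -
    have "\<exists>D. runs (tm_step M) C D \<and> y = config_code M D"
      by (rule simulation(2)[OF _ _ refl that]) (fact step halt)+
    then show ?thesis by blast
  qed
qed

text \<open>
  The state of the fold is a pair: a flag that is set at the first zero, and the reversed list of the
  letters before it.
\<close>

definition take_nonzero :: "nat \<Rightarrow> nat \<Rightarrow> nat" where
  "take_nonzero st a = (if pfst st = 0 then
     (if a = 0 then prod_encode (1, psnd st)
      else prod_encode (0, Suc (prod_encode (a, psnd st)))) else st)"

lemma foldl_take_nonzero:
  "psnd (foldl take_nonzero (prod_encode (0, list_encode us)) xs) =
    list_encode (rev (takeWhile (\<lambda>a. a \<noteq> 0) xs) @ us)"
proof (induction xs arbitrary: us)
  case (Cons x xs)
  have keep: "foldl take_nonzero (prod_encode (1, k)) ys = prod_encode (1, k)" for k ys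
    by (induction ys) (auto simp: take_nonzero_def)
  have "take_nonzero (prod_encode (0, k)) x =
      (if x = 0 then prod_encode (1, k) else prod_encode (0, Suc (prod_encode (x, k))))" for k
    by (simp add: take_nonzero_def)
  then show ?case using Cons[of "x # us"] keep by (cases "x = 0") simp_all
qed simp

text \<open>
  From the code of a final configuration to the code of the output.
\<close>

definition output_code :: "nat \<Rightarrow> nat" where
  "output_code z = list_encode (rev (list_decode
     (psnd (foldl take_nonzero 0 (list_decode (psnd (psnd (psnd z))))))))"

lemma total_recursive_output_code:
  assumes "total_recursive n f" shows "total_recursive n (\<lambda>xs. output_code (f xs))"
proof -
  have "total_recursive 3 (\<lambda>ys. take_nonzero (ys ! 1) (ys ! 2))"
    unfolding take_nonzero_def by (intro recs) auto
  then show ?thesis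
    unfolding output_code_def
    by (intro recs total_recursive_foldl[where f = "\<lambda>p. take_nonzero" and p = "\<lambda>xs. 0"] assms)
qed

lemma output_code_config_code:
  "output_code (config_code M (q, l, r)) = list_encode (takeWhile (\<lambda>a. a \<noteq> 0) r)"
proof -
  have "prod_encode (0, list_encode []) = 0" by (simp add: prod_encode_def)
  then show ?thesis using foldl_take_nonzero[of "[]" r] by (simp add: output_code_def config_code_def)
qed

definition start_code :: "nat \<Rightarrow> nat" where
  "start_code z = prod_encode (pfst z, prod_encode (0, prod_encode (0, psnd z)))"

lemma start_code: "start_code (tm_input_code (M, x)) = config_code M (0, [], x)"
  by (simp add: start_code_def config_code_def)

text \<open>
  It suffices that the machine iterates the step function on numbers given in unary. The coding of
  the simulated machine and its input is then the code of its initial configuration, in unary, and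
  the decoding extracts the output from the final configuration, whose code is the length of the
  output of \<open>U\<close>.
\<close>

theorem universal_tmI:
  assumes one: "1 \<in> tm_alphabet U"
    and halts: "\<And>x y. runs (orbit tm_step_code) x y \<Longrightarrow> tm_computes U (replicate x 1) (replicate y 1)"
    and loops: "\<And>x. tm_halts U (replicate x 1) \<Longrightarrow> \<exists>y. runs (orbit tm_step_code) x y"
  shows "universal_tm U"
proof -
  define enc where "enc = (\<lambda>Mx. replicate (start_code (tm_input_code Mx)) (1::nat))"
  define dec where "dec z = list_decode (output_code (length z))" for z :: "nat list"
  have enc: "enc (M, x) = replicate (config_code M (0, [], x)) 1" for M x
    by (simp add: enc_def start_code[symmetric])
  have computes: "tm_computes M x y \<longleftrightarrow>
      (\<exists>q l r. runs (tm_step M) (0, [], x) (q, l, r) \<and> y = takeWhile (\<lambda>a. a \<noteq> 0) r)" for M x y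
    unfolding tm_computes_def runs_def by blast
  have computes_unique: "y = z" if "tm_computes M x y" "tm_computes M x z" for M x y z
    using that unfolding computes by (metis prod.inject runs_unique)
  have fwd: "\<exists>z. tm_computes U (enc (M, x)) z \<and> dec z = y" if y: "tm_computes M x y" for M x y
  proof -
    obtain q l r where D: "runs (tm_step M) (0, [], x) (q, l, r)" "y = takeWhile (\<lambda>a. a \<noteq> 0) r"
      using y unfolding computes by blast
    have "dec (replicate (config_code M (q, l, r)) 1) = y"
      unfolding dec_def D(2) by (simp only: length_replicate output_code_config_code list_encode_inverse)
    then show ?thesis
      using halts[OF runs_tm_step_code(1)[OF D(1)]] unfolding enc by blast
  qed
  have "computable_on tm_input_code list_encode {(M, x). x \<in> tm_inputs M} enc"
  proof (rule computable_onI)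
    have "rec_nat 0 (\<lambda>k r. Suc (prod_encode (1, r))) n = list_encode (replicate n 1)" for n
      by (induction n) auto
    moreover have "total_recursive 1 (\<lambda>xs. rec_nat 0 (\<lambda>k r. Suc (prod_encode (1, r))) (start_code (xs ! 0)))"
      unfolding start_code_def by (intro recs total_recursive_rec_nat) auto
    ultimately show "total_recursive 1 (\<lambda>xs. list_encode (replicate (start_code (xs ! 0)) 1))" by simp
  qed (simp add: enc_def)
  moreover have "computable_on list_encode list_encode UNIV dec"
    using total_recursive_output_code[OF total_recursive_length_code[OF total_recursive_proj[of 0 1]]]
    by (intro computable_onI[where f = "\<lambda>z. output_code (length (list_decode z))"])
      (simp_all add: dec_def)
  moreover have "enc (M, x) \<in> tm_inputs U" for M x
    using one by (auto simp: enc_def tm_inputs_def)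
  moreover have "tm_halts U (enc (M, x)) \<longleftrightarrow> tm_halts M x" for M x
  proof
    assume "tm_halts U (enc (M, x))"
    then obtain y where "runs (orbit tm_step_code) (config_code M (0, [], x)) y"
      using loops unfolding enc by blast
    then obtain q l r where "runs (tm_step M) (0, [], x) (q, l, r)"
      using runs_tm_step_code(2) by (metis prod.exhaust)
    then show "tm_halts M x" unfolding tm_halts_def computes by blast
  next
    assume "tm_halts M x"
    then show "tm_halts U (enc (M, x))" using fwd unfolding tm_halts_def by blast
  qed
  moreover have "dec z = y" if "tm_computes M x y" "tm_computes U (enc (M, x)) z" for M x y z
    using fwd[OF that(1)] computes_unique[OF that(2)] by blast
  ultimately show ?thesis unfolding universal_tm_def by blast
qed


section \<open>Counter programs on a one-tape machine\<close>

text \<open>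
  The tape has \<open>k\<close> tracks: cell \<open>j\<close> is marked on track \<open>i\<close> iff counter \<open>i\<close> exceeds \<open>j\<close>. A symbol is the
  set of its marked tracks, as a number, so that the blank is the symbol without marks.
\<close>

definition cell :: "nat \<Rightarrow> (nat \<Rightarrow> nat) \<Rightarrow> nat \<Rightarrow> nat" where
  "cell k s j = set_encode {i. i < k \<and> j < s i}"

lemma mem_cell: "i \<in> set_decode (cell k s j) \<longleftrightarrow> i < k \<and> j < s i"
  by (simp add: cell_def set_encode_inverse)

lemma set_encode_less: "A \<subseteq> {..<k} \<Longrightarrow> set_encode A < 2 ^ k"
proof (induction k arbitrary: A)
  case (Suc k)
  have fin: "finite A" using Suc.prems finite_subset by blast
  have "set_encode (A - {k}) < 2 ^ k" using Suc.prems by (intro Suc.IH) auto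
  moreover have "set_encode A \<le> set_encode (A - {k}) + 2 ^ k"
  proof (cases "k \<in> A")
    case True
    then show ?thesis using fin by (simp add: set_encode_def sum.remove)
  qed simp
  ultimately show ?case by simp
qed (simp add: set_encode_def)

lemma cell_less: "cell k s j < 2 ^ k"
  unfolding cell_def by (rule set_encode_less) auto

lemma cell_eq_0: "(\<And>i. s i \<le> j) \<Longrightarrow> cell k s j = 0"
  by (simp add: cell_def leD)

lemma set_decode_less: "a < 2 ^ k \<Longrightarrow> set_decode a \<subseteq> {..<k}"
proof
  fix i assume "a < 2 ^ k" "i \<in> set_decode a"
  then have "2 ^ i \<le> a" by (auto simp: set_decode_def intro!: leI)
  then have "(2::nat) ^ i < 2 ^ k" using \<open>a < 2 ^ k\<close> by linarith
  then show "i \<in> {..<k}" by simp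
qed

definition cells :: "nat \<Rightarrow> (nat \<Rightarrow> nat) \<Rightarrow> nat \<Rightarrow> nat \<Rightarrow> nat list" where
  "cells k s m n = map (cell k s) [m..<n]"

lemma cells_split: "j \<le> m \<Longrightarrow> cells k s 0 m = cells k s 0 j @ cells k s j m"
  unfolding cells_def by (metis map_append upt_add_eq_append le0 le_add_diff_inverse)

text \<open>
  If \<open>j = m\<close>, the cell at \<open>j\<close> lies just beyond the recorded part of the tape, and the result is longer by
  one cell.
\<close>

lemma cells_join: "j \<le> m \<Longrightarrow> cells k s 0 j @ cell k s j # cells k s (Suc j) m = cells k s 0 (max m (Suc j))"
  using cells_split[of j "max m (Suc j)" k s]
  by (cases "j < m") (auto simp: cells_def upt_conv_Cons max_def)

lemma cells_cong: "(\<And>j. m \<le> j \<Longrightarrow> j < n \<Longrightarrow> cell k s j = cell k t j) \<Longrightarrow> cells k s m n = cells k t m n"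
  by (simp add: cells_def)

lemma tape_hd_cells: "\<forall>i. s i \<le> m \<Longrightarrow> j \<le> m \<Longrightarrow> tape_hd (cells k s j m) = cell k s j"
  by (cases "j < m") (auto simp: cells_def upt_conv_Cons cell_eq_0)

lemma tl_cells: "tl (cells k s j m) = cells k s (Suc j) m"
  by (cases "j < m") (auto simp: cells_def upt_conv_Cons)

text \<open>
  While instruction \<open>i\<close> is executed, the phase \<open>t\<close> is 3, 4 or 5 and the state is \<open>4 * i + t\<close>. To increment
  \<open>r\<close>, the head runs right to the first cell not marked on track \<open>r\<close> and marks it. To decrement, phase 3
  tests the first cell, phase 4 runs to the first unmarked cell, and phase 5 erases the mark to
  its left. The last step enters the state \<open>4 * e + 2\<close> or \<open>4 * z + 2\<close>, which brings the head back to the marker at the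
  left end of the tape.
\<close>

fun instr_table :: "instr \<Rightarrow> nat \<Rightarrow> nat \<Rightarrow> nat \<Rightarrow> nat \<times> nat \<times> direction" where
  "instr_table (Inc r e) i t a =
     (if r \<in> set_decode a then (4 * i + 3, a, direction.R)
      else (4 * e + 2, set_encode (insert r (set_decode a)), direction.L))"
| "instr_table (Dec r e z) i t a =
     (if t = 3 then
        (if r \<in> set_decode a then (4 * i + 4, a, direction.R) else (4 * z + 2, a, direction.L))
      else if t = 4 then
        (if r \<in> set_decode a then (4 * i + 4, a, direction.R) else (4 * i + 5, a, direction.L))
      else (4 * e + 2, set_encode (set_decode a - {r}), direction.L))"

text \<open>
  The symbol \<open>2 ^ k\<close> is the marker at the left end of the tape. States 0 and 1 prepare the tape: every
  nonblank input symbol is overwritten by a mark on track 0, so that arbitrary input words are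
  treated like unary numbers, and the marker is put to their left. The state \<open>4 * i + 2\<close> runs left to the
  marker and then starts instruction \<open>i\<close>; if \<open>i\<close> is the length of the program, the machine
  enters a state without transitions instead, with the head on the first cell.
\<close>

definition counter_tm_table :: "instr list \<Rightarrow> nat \<Rightarrow> nat \<times> nat \<Rightarrow> (nat \<times> nat \<times> direction) option" where
  "counter_tm_table P k = (\<lambda>(q, a).
     if a > 2 ^ k \<or> q > 4 * length P + 2 then None
     else if q = 0 then Some (if a = 0 then (1, 0, direction.L) else (0, 1, direction.R))
     else if q = 1 then Some (if a = 0 then (2, 2 ^ k, direction.R) else (1, a, direction.L))
     else if q mod 4 = 2 then Some (if a = 2 ^ k then (q + 1, a, direction.R) else (q, a, direction.L))
     else if a = 2 ^ k then None
     else let i = (q - 3) div 4 in Some (instr_table (P ! i) i ((q - 3) mod 4 + 3) a))"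

lemma finite_dom_counter_tm_table: "finite (dom (counter_tm_table P k))"
proof (rule finite_subset)
  show "dom (counter_tm_table P k) \<subseteq> {..4 * length P + 2} \<times> {..2 ^ k}"
    by (auto simp: counter_tm_table_def split: if_splits)
qed simp

text \<open>
  The alphabet of a machine is read off its whole table, including entries hidden by earlier ones
  with the same key; distinct keys exclude hidden entries.
\<close>

definition counter_tm :: "instr list \<Rightarrow> nat \<Rightarrow> turing_machine" where
  "counter_tm P k = (SOME M. map_of M = counter_tm_table P k \<and> distinct (map fst M))"

lemma counter_tm: "map_of (counter_tm P k) = counter_tm_table P k" "distinct (map fst (counter_tm P k))"
proof -
  let ?f = "counter_tm_table P k"
  obtain xs where xs: "set xs = dom ?f" "distinct xs"
    using finite_distinct_list[OF finite_dom_counter_tm_table] by blast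
  let ?M = "map (\<lambda>x. (x, the (?f x))) xs"
  have "map_of ?M = ?f" using xs(1) by (rule map_of_map_keys)
  moreover have "distinct (map fst ?M)" using xs(2) by (simp add: o_def)
  ultimately have "\<exists>M. map_of M = ?f \<and> distinct (map fst M)" by blast
  from someI_ex[OF this] show "map_of (counter_tm P k) = ?f" "distinct (map fst (counter_tm P k))"
    unfolding counter_tm_def by blast+
qed

locale counter_machine =
  fixes P :: "instr list" and k :: nat
  assumes program: "counter_program P k"
begin

lemma k_pos: "0 < k" and reg_less: "i < length P \<Longrightarrow> reg (P ! i) < k"
  and target_le: "i < length P \<Longrightarrow> e \<in> targets (P ! i) \<Longrightarrow> e \<le> length P"
  using program nth_mem[of i P] unfolding counter_program_def by auto

abbreviation "U \<equiv> counter_tm P k"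
abbreviation "table \<equiv> counter_tm_table P k"
abbreviation "steps \<equiv> (\<lambda>x y. tm_step U x = Some y)\<^sup>*\<^sup>*"

lemma step_R: "table (q, tape_hd r) = Some (q', b, direction.R) \<Longrightarrow> tm_step U (q, l, r) = Some (q', b # l, tl r)"
  by (simp add: counter_tm)

lemma step_L: "table (q, tape_hd r) = Some (q', b, direction.L) \<Longrightarrow>
    tm_step U (q, l, r) = Some (q', tl l, tape_hd l # b # tl r)"
  by (simp add: counter_tm)

lemma steps_R: "table (q, tape_hd r) = Some (q', b, direction.R) \<Longrightarrow> w = tl r \<Longrightarrow>
    steps (q, l, r) (q', b # l, w)"
  using step_R by (simp add: r_into_rtranclp del: tm_step.simps)

lemma steps_L: "table (q, tape_hd r) = Some (q', b, direction.L) \<Longrightarrow> w = tl r \<Longrightarrow>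
    steps (q, l, r) (q', tl l, tape_hd l # b # w)"
  using step_L by (simp add: r_into_rtranclp del: tm_step.simps)

lemma scan_right:
  assumes "\<forall>a\<in>set w. table (q, a) = Some (q, a, direction.R)"
  shows "steps (q, l, w @ r) (q, rev w @ l, r)"
  using assms
proof (induction w arbitrary: l)
  case (Cons a w)
  then have "tm_step U (q, l, (a # w) @ r) = Some (q, a # l, w @ r)" by (subst step_R) auto
  moreover have "steps (q, a # l, w @ r) (q, rev w @ a # l, r)" using Cons by simp
  ultimately show ?case by (simp add: converse_rtranclp_into_rtranclp del: tm_step.simps)
qed simp

lemma scan_left:
  assumes "\<forall>a\<in>set (b # w). table (q, a) = Some (q, a, direction.L)"
  shows "steps (q, w @ c # l, b # r) (q, l, c # rev w @ b # r)"
  using assms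
proof (induction w arbitrary: b r)
  case Nil
  then have "tm_step U (q, [] @ c # l, b # r) = Some (q, l, c # b # r)" by (subst step_L) auto
  then show ?case by (simp add: r_into_rtranclp del: tm_step.simps)
next
  case (Cons a w)
  then have "tm_step U (q, (a # w) @ c # l, b # r) = Some (q, w @ c # l, a # b # r)" by (subst step_L) auto
  moreover have "steps (q, w @ c # l, a # b # r) (q, l, c # rev w @ a # b # r)"
    using Cons by simp
  ultimately show ?case by (simp add: converse_rtranclp_into_rtranclp del: tm_step.simps)
qed

lemma table_return:
  assumes "i \<le> length P"
  shows "a < 2 ^ k \<Longrightarrow> table (4 * i + 2, a) = Some (4 * i + 2, a, direction.L)"
    "table (4 * i + 2, 2 ^ k) = Some (4 * i + 3, 2 ^ k, direction.R)"
proof -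
  have "(4 * i + 2) mod 4 = 2" by presburger
  then show "a < 2 ^ k \<Longrightarrow> table (4 * i + 2, a) = Some (4 * i + 2, a, direction.L)"
    "table (4 * i + 2, 2 ^ k) = Some (4 * i + 3, 2 ^ k, direction.R)"
    using assms by (simp_all add: counter_tm_table_def)
qed

lemma table_work:
  assumes "i < length P" "t \<in> {3, 4, 5}" "a < 2 ^ k"
  shows "table (4 * i + t, a) = Some (instr_table (P ! i) i t a)"
proof -
  obtain u where u: "t = u + 3" "u \<le> 2" using assms(2) by (auto intro: that[of "t - 3"])
  have "(4 * i + t) mod 4 \<noteq> 2" using u by presburger
  moreover have "4 * i + t - 3 = 4 * i + u" using u by simp
  moreover have "(4 * i + u) div 4 = i" "(4 * i + u) mod 4 = u" using u by auto
  moreover have "4 * i + t \<le> 4 * length P + 2" "4 * i + t > 1" using u assms(1) by auto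
  ultimately show ?thesis using assms(3) u(1)
    unfolding counter_tm_table_def by (simp add: Let_def)
qed

lemma return_to_marker:
  assumes "i \<le> length P" "\<forall>a\<in>set u. a < 2 ^ k"
  shows "steps (4 * i + 2, tl (rev u @ [2 ^ k]), tape_hd (rev u @ [2 ^ k]) # r) (4 * i + 2, [], 2 ^ k # u @ r)"
proof (cases u rule: rev_cases)
  case (snoc v a)
  have "steps (4 * i + 2, rev v @ 2 ^ k # [], a # r) (4 * i + 2, [], 2 ^ k # rev (rev v) @ a # r)"
    by (rule scan_left) (use snoc assms table_return(1)[OF assms(1)] in simp)
  then show ?thesis using snoc by simp
qed simp

lemma cells_less: "\<forall>a\<in>set (cells k s m n). a < 2 ^ k"
  by (auto simp: cells_def cell_less)

text \<open>
  The bound \<open>m\<close> is not determined by the counters: the tape may carry further blanks.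
\<close>

definition represents :: "nat \<times> (nat \<Rightarrow> nat) \<Rightarrow> tm_config \<Rightarrow> bool" where
  "represents c C \<longleftrightarrow> (case c of (i, s) \<Rightarrow> i \<le> length P \<and>
     (\<exists>m. (\<forall>r. s r \<le> m) \<and> C = (4 * i + 2, [], 2 ^ k # cells k s 0 m)))"

lemma represents_step:
  assumes "represents c C" "counter_step P c = Some d"
  shows "\<exists>D. (\<lambda>x y. tm_step U x = Some y)\<^sup>+\<^sup>+ C D \<and> represents d D"
proof -
  obtain i s where c: "c = (i, s)" by fastforce
  then obtain m where i: "i < length P" and m: "\<forall>r. s r \<le> m"
    and C: "C = (4 * i + 2, [], 2 ^ k # cells k s 0 m)"
    using assms by (auto simp: represents_def split: if_splits)
  have "tm_step U C = Some (4 * i + 3, [2 ^ k], cells k s 0 m)"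
    using table_return(2)[of i] i unfolding C by (subst step_R) auto
  then have start: "(\<lambda>x y. tm_step U x = Some y)\<^sup>+\<^sup>+ C D" if "steps (4 * i + 3, [2 ^ k], cells k s 0 m) D" for D
    using that by (rule rtranclp_into_tranclp2)
  note work = table_work[OF i _ cell_less, simplified]
  show ?thesis
  proof (cases "P ! i")
    case (Inc r e)
    \<comment> \<open>Cell \<open>s r\<close> is the first cell not marked on track \<open>r\<close>.\<close>
    let ?j = "s r" and ?s = "s(r := Suc (s r))"
    have r: "r < k" using reg_less[OF i] Inc by simp
    have e: "e \<le> length P" using target_le[OF i] Inc by simp
    have d: "d = (e, ?s)" using assms(2) i Inc c by simp
    have "insert r (set_decode (cell k s ?j)) = {i. i < k \<and> ?j < ?s i}"
      using r by (auto simp: mem_cell)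
    then have enc: "set_encode (insert r (set_decode (cell k s ?j))) = cell k ?s ?j"
      by (simp add: cell_def)
    have 1: "steps (4 * i + 3, [2 ^ k], cells k s 0 ?j @ cells k s ?j m)
        (4 * i + 3, rev (cells k s 0 ?j) @ [2 ^ k], cells k s ?j m)"
      by (rule scan_right) (use Inc r in \<open>auto simp: cells_def work mem_cell\<close>)
    have 2: "steps (4 * i + 3, rev (cells k s 0 ?j) @ [2 ^ k], cells k s ?j m)
        (4 * e + 2, tl (rev (cells k s 0 ?j) @ [2 ^ k]),
         tape_hd (rev (cells k s 0 ?j) @ [2 ^ k]) # cell k ?s ?j # cells k s (Suc ?j) m)"
      using m Inc enc by (intro steps_L) (auto simp: tape_hd_cells tl_cells work mem_cell)
    have 3: "steps (4 * e + 2, tl (rev (cells k s 0 ?j) @ [2 ^ k]),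
         tape_hd (rev (cells k s 0 ?j) @ [2 ^ k]) # cell k ?s ?j # cells k s (Suc ?j) m)
        (4 * e + 2, [], 2 ^ k # cells k s 0 ?j @ cell k ?s ?j # cells k s (Suc ?j) m)"
      by (rule return_to_marker[OF e cells_less])
    have "cells k s 0 ?j = cells k ?s 0 ?j" "cells k s (Suc ?j) m = cells k ?s (Suc ?j) m"
      by (rule cells_cong; auto simp: cell_def intro!: arg_cong[of _ _ set_encode])+
    then have "cells k s 0 ?j @ cell k ?s ?j # cells k s (Suc ?j) m = cells k ?s 0 (max m (Suc ?j))"
      using m cells_join[of ?j m k ?s] by simp
    with rtranclp_trans[OF 1 rtranclp_trans[OF 2 3]]
    have "steps (4 * i + 3, [2 ^ k], cells k s 0 m) (4 * e + 2, [], 2 ^ k # cells k ?s 0 (max m (Suc ?j)))"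
      using cells_split[of ?j m k s] m by simp
    moreover have "represents d (4 * e + 2, [], 2 ^ k # cells k ?s 0 (max m (Suc ?j)))"
      unfolding represents_def d using e m by (auto intro!: exI[of _ "max m (Suc ?j)"] simp: le_max_iff_disj)
    ultimately show ?thesis using start by blast
  next
    case (Dec r e z)
    have r: "r < k" using reg_less[OF i] Dec by simp
    have e: "e \<le> length P" "z \<le> length P" using target_le[OF i] Dec by simp_all
    show ?thesis
    proof (cases "s r")
      case 0
      then have d: "d = (z, s)" using assms(2) i Dec c by simp
      have "cell k s 0 # cells k s (Suc 0) m = cells k s 0 (max m (Suc 0))"
        using cells_join[of 0 m k s] by (simp add: cells_def)
      moreover have "steps (4 * i + 3, [2 ^ k], cells k s 0 m)
        (4 * z + 2, tl [2 ^ k], tape_hd [2 ^ k] # cell k s 0 # cells k s (Suc 0) m)"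
        using m Dec 0 by (intro steps_L) (auto simp: tape_hd_cells tl_cells work mem_cell)
      ultimately have "steps (4 * i + 3, [2 ^ k], cells k s 0 m) (4 * z + 2, [], 2 ^ k # cells k s 0 (max m (Suc 0)))"
        unfolding list.sel tape_hd.simps by simp
      moreover have "represents d (4 * z + 2, [], 2 ^ k # cells k s 0 (max m (Suc 0)))"
        unfolding represents_def d using e m by (auto intro!: exI[of _ "max m (Suc 0)"] simp: le_max_iff_disj)
      ultimately show ?thesis using start by blast
    next
      case (Suc j)
      \<comment> \<open>Cell \<open>j\<close> is the last cell marked on track \<open>r\<close>; the head has to pass it to find out.\<close>
      let ?s = "s(r := j)"
      have d: "d = (e, ?s)" using assms(2) i Dec c Suc by simp
      have jm: "Suc j \<le> m" using m Suc by metis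
      have split: "cells k s 0 m = cell k s 0 # cells k s (Suc 0) (Suc j) @ cells k s (Suc j) m"
        using cells_split[OF jm, of k s] by (simp add: cells_def upt_conv_Cons del: upt_Suc)
      have snoc: "cell k s 0 # cells k s (Suc 0) (Suc j) = cells k s 0 j @ [cell k s j]"
      proof -
        have "cells k s 0 (Suc j) = cell k s 0 # cells k s (Suc 0) (Suc j)"
          by (simp add: cells_def upt_conv_Cons del: upt_Suc)
        moreover have "cells k s 0 (Suc j) = cells k s 0 j @ [cell k s j]" by (simp add: cells_def)
        ultimately show ?thesis by simp
      qed
      have "set_decode (cell k s j) - {r} = {i. i < k \<and> j < ?s i}"
        using r by (auto simp: mem_cell)
      then have enc: "set_encode (set_decode (cell k s j) - {r}) = cell k ?s j" by (simp add: cell_def)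
      let ?l = "rev (cells k s 0 j) @ [2 ^ k]" and ?r = "cells k s (Suc (Suc j)) m"
      have 1: "steps (4 * i + 3, [2 ^ k], cells k s 0 m)
        (4 * i + 4, [cell k s 0, 2 ^ k], cells k s (Suc 0) (Suc j) @ cells k s (Suc j) m)"
        unfolding split using Dec Suc r by (intro steps_R) (auto simp: work mem_cell)
      have "steps (4 * i + 4, [cell k s 0, 2 ^ k], cells k s (Suc 0) (Suc j) @ cells k s (Suc j) m)
        (4 * i + 4, rev (cells k s (Suc 0) (Suc j)) @ [cell k s 0, 2 ^ k], cells k s (Suc j) m)"
        by (rule scan_right) (use Dec r Suc in \<open>auto simp: cells_def work mem_cell\<close>)
      moreover have "rev (cells k s (Suc 0) (Suc j)) @ [cell k s 0, 2 ^ k] = cell k s j # ?l"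
        using arg_cong[OF snoc, of rev] by simp
      ultimately have 2: "steps (4 * i + 4, [cell k s 0, 2 ^ k], cells k s (Suc 0) (Suc j) @ cells k s (Suc j) m)
        (4 * i + 4, cell k s j # ?l, cells k s (Suc j) m)"
        by (simp only:)
      have 3: "steps (4 * i + 4, cell k s j # ?l, cells k s (Suc j) m)
        (4 * i + 5, tl (cell k s j # ?l), tape_hd (cell k s j # ?l) # cell k s (Suc j) # ?r)"
        using m jm Dec Suc by (intro steps_L) (auto simp: tape_hd_cells tl_cells work mem_cell)
      have 4: "steps (4 * i + 5, tl (cell k s j # ?l), tape_hd (cell k s j # ?l) # cell k s (Suc j) # ?r)
        (4 * e + 2, tl ?l, tape_hd ?l # cell k ?s j # cell k s (Suc j) # ?r)"
        using Dec enc unfolding list.sel tape_hd.simps by (intro steps_L) (auto simp: work)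
      have 5: "steps (4 * e + 2, tl ?l, tape_hd ?l # cell k ?s j # cell k s (Suc j) # ?r)
        (4 * e + 2, [], 2 ^ k # cells k s 0 j @ cell k ?s j # cell k s (Suc j) # ?r)"
        by (rule return_to_marker[OF e(1) cells_less])
      have "cell k s i = cell k ?s i" if "i \<noteq> j" for i
        using that Suc by (auto simp: cell_def intro!: arg_cong[of _ _ set_encode])
      then have "cells k s 0 j @ cell k ?s j # cell k s (Suc j) # ?r =
        cells k ?s 0 j @ cell k ?s j # cell k ?s (Suc j) # cells k ?s (Suc (Suc j)) m"
        by (auto simp: cells_def)
      also have "\<dots> = cells k ?s 0 (max m (Suc (Suc j)))"
        using cells_join[OF jm, of k ?s] by (simp add: cells_def)
      finally have "steps (4 * i + 3, [2 ^ k], cells k s 0 m)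
        (4 * e + 2, [], 2 ^ k # cells k ?s 0 (max m (Suc (Suc j))))"
        using rtranclp_trans[OF 1 rtranclp_trans[OF 2 rtranclp_trans[OF 3 rtranclp_trans[OF 4 5]]]]
        by (simp only:)
      moreover have "represents d (4 * e + 2, [], 2 ^ k # cells k ?s 0 (max m (Suc (Suc j))))"
        unfolding represents_def d using e m jm by (auto intro!: exI[of _ "max m (Suc (Suc j))"] simp: le_max_iff_disj)
      ultimately show ?thesis using start by blast
    qed
  qed
qed

lemma represents_halt:
  assumes "represents c C" "counter_step P c = None"
  shows "\<exists>D. runs (tm_step U) C D \<and> (\<exists>s m. c = (length P, s) \<and> (\<forall>r. s r \<le> m) \<and>
     D = (4 * length P + 3, [2 ^ k], cells k s 0 m))"
proof -
  obtain s m where c: "c = (length P, s)" and m: "\<forall>r. s r \<le> m"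
    and C: "C = (4 * length P + 2, [], 2 ^ k # cells k s 0 m)"
    using assms by (cases c) (auto simp: represents_def split: if_splits instr.splits)
  let ?D = "(4 * length P + 3, [2 ^ k], cells k s 0 m)"
  have "tm_step U C = Some ?D"
    using table_return(2)[of "length P"] unfolding C by (subst step_R) auto
  moreover have "tm_step U ?D = None" by (simp add: counter_tm counter_tm_table_def)
  ultimately have "runs (tm_step U) C ?D" unfolding runs_def by (simp add: r_into_rtranclp)
  then show ?thesis using c m by blast
qed

lemma tm_alphabet_le: "a \<in> tm_alphabet U \<Longrightarrow> a \<le> 2 ^ k"
proof -
  have "x \<le> 2 ^ k \<and> y \<le> 2 ^ k" if "((q, x), (q', y, d)) \<in> set U" for q x q' y d
  proof -
    have t: "table (q, x) = Some (q', y, d)"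
      using that counter_tm by (metis map_of_eq_Some_iff)
    have x: "x \<le> 2 ^ k" using t by (auto simp: counter_tm_table_def split: if_splits)
    have sets: "set_encode (insert r (set_decode x)) < 2 ^ k \<and> set_encode (set_decode x - {r}) < 2 ^ k"
      if "r < k" "x < 2 ^ k" for r
      using that set_decode_less[of x k] by (auto intro!: set_encode_less)
    have "y < 2 ^ k" if "instr_table (P ! i) i j x = (q', y, d)" "x < 2 ^ k" "i < length P" for i j
      using that sets[of "reg (P ! i)"] reg_less[of i] by (cases "P ! i") (auto split: if_splits)
    moreover have "(q - 3) div 4 < length P" if "q \<le> 4 * length P + 2" "q \<noteq> 0" "q \<noteq> 1" "q mod 4 \<noteq> 2"
    proof -
      have "q \<noteq> 4 * length P + 2" "q \<noteq> 2" using that(4) by presburger+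
      then have "q - 3 < length P * 4" using that(1-3) by linarith
      then show ?thesis by (rule less_mult_imp_div_less)
    qed
    ultimately have "y \<le> 2 ^ k"
      using t k_pos unfolding counter_tm_table_def Let_def
      by (auto split: if_splits) (metis le_neq_implies_less less_imp_le_nat not_less)
    with x show ?thesis ..
  qed
  then show "a \<le> 2 ^ k" if "a \<in> tm_alphabet U" using that by (fastforce simp: tm_alphabet_def)
qed

lemma one_in_alphabet: "1 \<in> tm_alphabet U"
proof -
  have "map_of U (0, 1) = Some (0, 1, direction.R)" by (simp add: counter_tm counter_tm_table_def)
  then have "((0, 1), (0, 1, direction.R)) \<in> set U" by (rule map_of_SomeD)
  then show ?thesis by (force simp: tm_alphabet_def)
qed

lemma cell_input: "cell k (input_registers n) j = (if j < n then 1 else 0)"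
proof -
  have "{i. i < k \<and> j < input_registers n i} = (if j < n then {0} else {})"
    using k_pos by (auto simp: input_registers_def)
  then show ?thesis by (simp add: cell_def set_encode_def)
qed

text \<open>
  The input determines only its length, because every letter is overwritten by the same
  symbol.
\<close>

lemma represents_start:
  assumes "x \<in> tm_inputs U"
  shows "\<exists>C. steps (0, [], x) C \<and> represents (0, input_registers (length x)) C"
proof -
  let ?n = "length x"
  have x: "\<forall>a\<in>set x. a \<noteq> 0 \<and> a \<le> 2 ^ k"
    using assms tm_alphabet_le by (auto simp: tm_inputs_def)
  have fw: "steps (0, l, y) (0, replicate (length y) 1 @ l, [])" if "\<forall>a\<in>set y. a \<noteq> 0 \<and> a \<le> 2 ^ k" for l y
    using that
  proof (induction y arbitrary: l)
    case (Cons a y)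
    then have "tm_step U (0, l, a # y) = Some (0, 1 # l, y)" by (subst step_R) (auto simp: counter_tm_table_def)
    moreover have "steps (0, 1 # l, y) (0, replicate (length y) 1 @ 1 # l, [])" using Cons by simp
    ultimately show ?case
      by (simp add: converse_rtranclp_into_rtranclp replicate_app_Cons_same del: tm_step.simps)
  qed simp
  have rewind: "steps (1, tl (replicate n 1), tape_hd (replicate n 1) # w) (1, [], 0 # replicate n 1 @ w)" for n w
  proof (induction n arbitrary: w)
    case (Suc n)
    have "tm_step U (1, replicate n 1, 1 # w) = Some (1, tl (replicate n 1), tape_hd (replicate n 1) # 1 # w)"
      by (subst step_L) (auto simp: counter_tm_table_def)
    then show ?case using Suc[of "1 # w"]
      by (simp add: converse_rtranclp_into_rtranclp replicate_app_Cons_same del: tm_step.simps)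
  qed simp
  let ?w = "cells k (input_registers ?n) 0 (Suc ?n)"
  have w: "replicate ?n 1 @ [0] = ?w"
    by (rule nth_equalityI) (auto simp: cells_def cell_input nth_append simp del: upt_Suc)
  have 1: "steps (0, [], x) (0, replicate ?n 1, [])" using fw[OF x, of "[]"] by simp
  have 2: "steps (0, replicate ?n 1, []) (1, tl (replicate ?n 1), tape_hd (replicate ?n 1) # [0])"
    by (rule steps_L) (auto simp: counter_tm_table_def)
  have 3: "steps (1, [], 0 # replicate ?n 1 @ [0]) (2, [2 ^ k], replicate ?n 1 @ [0])"
    by (rule steps_R) (auto simp: counter_tm_table_def)
  have "steps (2, [2 ^ k], ?w) (2, tl [2 ^ k], tape_hd [2 ^ k] # cell k (input_registers ?n) 0 # tl ?w)"
    using table_return(1)[of 0, OF _ cell_less, unfolded mult_0_right add_0]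
    by (intro steps_L) (auto simp: cells_def upt_conv_Cons simp del: upt_Suc)
  moreover have "cell k (input_registers ?n) 0 # tl ?w = ?w"
    by (simp add: cells_def upt_conv_Cons del: upt_Suc)
  ultimately have 4: "steps (2, [2 ^ k], ?w) (2, [], 2 ^ k # ?w)" by simp
  have "steps (0, [], x) (2, [], 2 ^ k # ?w)"
    using rtranclp_trans[OF 1 rtranclp_trans[OF 2 rtranclp_trans[OF rewind 3]]] rtranclp_trans[OF _ 4]
    unfolding w by blast
  moreover have "represents (0, input_registers ?n) (2, [], 2 ^ k # ?w)"
    unfolding represents_def prod.case
    by (intro conjI exI[of _ "Suc ?n"]) (simp_all add: input_registers_def)
  ultimately show ?thesis by blast
qed

text \<open>
  If all counters other than counter 0 are zero, the cells marked at all are those marked on track 0, so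
  the output is the content of counter 0 in unary.
\<close>

theorem counter_tm_computes:
  assumes "x \<in> tm_inputs U"
  shows "runs (counter_step P) (0, input_registers (length x)) (i, input_registers y) \<Longrightarrow>
      tm_computes U x (replicate y 1)"
    and "tm_halts U x \<longleftrightarrow> (\<exists>c. runs (counter_step P) (0, input_registers (length x)) c)"
proof -
  let ?c = "(0, input_registers (length x))"
  let ?Q = "\<lambda>c D. \<exists>s m. c = (length P, s) \<and> (\<forall>r. s r \<le> m) \<and>
     D = (4 * length P + 3, [2 ^ k], cells k s 0 m)"
  note simulation = runs_simulation[where Sim = represents and f = "counter_step P" and g = "tm_step U" and Q = ?Q]
  obtain C where C: "steps (0, [], x) C" "represents ?c C"
    using represents_start[OF assms] by blast
  have fwd: "\<exists>D. runs (tm_step U) (0, [], x) D \<and> ?Q d D" if "runs (counter_step P) ?c d" for d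
  proof -
    have "\<exists>D. runs (tm_step U) C D \<and> ?Q d D"
      by (rule simulation(1)[OF _ _ C(2) that]) (fact represents_step represents_halt)+
    then show ?thesis using runs_prepend[OF C(1)] by blast
  qed
  have bwd: "\<exists>d. runs (counter_step P) ?c d" if "runs (tm_step U) (0, [], x) D" for D
  proof -
    have "\<exists>d. runs (counter_step P) ?c d \<and> ?Q d D"
      by (rule simulation(2)[OF _ _ C(2) runs_strip[OF C(1) that]]) (fact represents_step represents_halt)+
    then show ?thesis by blast
  qed
  have computes: "tm_computes U x z \<longleftrightarrow>
      (\<exists>q l r. runs (tm_step U) (0, [], x) (q, l, r) \<and> z = takeWhile (\<lambda>a. a \<noteq> 0) r)" for z
    unfolding tm_computes_def runs_def by blast
  show "tm_computes U x (replicate y 1)" if y: "runs (counter_step P) ?c (i, input_registers y)"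
  proof -
    obtain m where m: "\<forall>r. input_registers y r \<le> m"
      and D: "runs (tm_step U) (0, [], x) (4 * length P + 3, [2 ^ k], cells k (input_registers y) 0 m)"
      using fwd[OF y] by auto
    have "y \<le> m" using m by (auto simp: input_registers_def dest: spec[of _ 0])
    then have "cells k (input_registers y) 0 m = replicate y 1 @ replicate (m - y) 0"
      by (intro nth_equalityI) (auto simp: cells_def cell_input nth_append)
    moreover have ones: "takeWhile (\<lambda>a. a \<noteq> 0) (replicate y 1 @ replicate n 0) = replicate y (1::nat)" for y n
      by (induction y) (cases n; simp)+
    ultimately have "takeWhile (\<lambda>a. a \<noteq> 0) (cells k (input_registers y) 0 m) = replicate y 1"
      using ones[of y "m - y"] by simp
    then show ?thesis using D unfolding computes by metis
  qed
  show "tm_halts U x \<longleftrightarrow> (\<exists>c. runs (counter_step P) ?c c)"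
    unfolding tm_halts_def computes using fwd bwd by fast
qed

end


section \<open>Counter programs as tag systems\<close>

abbreviation rep :: "nat \<Rightarrow> 'a list \<Rightarrow> 'a list" where
  "rep n w \<equiv> concat (replicate n w)"

lemma rep_add: "rep (m + n) w = rep m w @ rep n w"
  by (simp add: replicate_add)

lemma rep_mult: "rep n (rep m w) = rep (n * m) w"
  by (induction n) (simp_all add: replicate_add)

lemma rep_rotate: "rep (Suc n) (a @ b) = a @ rep n (b @ a) @ b"
  by (induction n) simp_all

lemma length_rep [simp]: "length (rep n w) = n * length w"
  by (induction n) simp_all

definition tag_next :: "'a tag_system \<Rightarrow> 'a list \<Rightarrow> 'a list option" where
  "tag_next T w = (if tag_nonhalting T w then Some (tag_step T w) else None)"

lemma tag_halts_iff_runs: "tag_halts T w \<longleftrightarrow> (\<exists>w'. runs (tag_next T) w w')"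
proof -
  have "(\<lambda>u u'. tag_nonhalting T u \<and> u' = tag_step T u) = (\<lambda>u u'. tag_next T u = Some u')"
    by (auto simp: tag_next_def fun_eq_iff)
  moreover have "tag_next T w' = None \<longleftrightarrow> \<not> tag_nonhalting T w'" for w'
    by (simp add: tag_next_def)
  ultimately show ?thesis unfolding tag_halts_def runs_def by simp
qed

text \<open>
  If a word begins with pieces whose length is the deletion number, each step consumes one piece,
  and only the first letter of a piece matters.
\<close>

lemma tag_pass:
  assumes "\<forall>w\<in>set ws. length w = deletion T" "0 < deletion T"
  shows "(\<lambda>x y. tag_next T x = Some y)\<^sup>*\<^sup>* (concat ws @ u) (u @ concat (map (\<lambda>w. production T (hd w)) ws))"
  using assms
proof (induction ws arbitrary: u)
  case (Cons w ws)
  then have "w \<noteq> []" by auto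
  then have "tag_next T (concat (w # ws) @ u) = Some (concat ws @ u @ production T (hd w))"
    using Cons.prems by (simp add: tag_next_def tag_nonhalting_def tag_step_def)
  moreover have "(\<lambda>x y. tag_next T x = Some y)\<^sup>*\<^sup>* (concat ws @ u @ production T (hd w))
      ((u @ production T (hd w)) @ concat (map (\<lambda>w. production T (hd w)) ws))"
    using Cons.IH[of "u @ production T (hd w)"] Cons.prems by simp
  ultimately show ?case by (simp add: converse_rtranclp_into_rtranclp)
qed simp

definition nth_prime :: "nat \<Rightarrow> nat" where
  "nth_prime i = enumerate {p. prime p} i"

lemma prime_nth_prime: "prime (nth_prime i)"
  using enumerate_in_set[OF primes_infinite, of i] by (simp add: nth_prime_def)

lemma nth_prime_less: "i < j \<Longrightarrow> nth_prime i < nth_prime j"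
  unfolding nth_prime_def by (rule enumerate_mono[OF _ primes_infinite])

lemma nth_prime_eq_iff: "nth_prime i = nth_prime j \<longleftrightarrow> i = j"
  by (metis nth_prime_less less_irrefl linorder_neqE_nat)

text \<open>
  A letter has a kind \<open>t\<close>, the address \<open>i\<close> of an instruction, and an offset \<open>j\<close>, which is used by the
  probing letters only.
\<close>

definition letter :: "nat \<Rightarrow> nat \<Rightarrow> nat \<Rightarrow> nat" where
  "letter t i j = prod_encode (t, prod_encode (i, j))"

lemma letter_eq_iff [simp]: "letter t i j = letter t' i' j' \<longleftrightarrow> t = t' \<and> i = i' \<and> j = j'"
  by (simp add: letter_def)

abbreviation "filler \<equiv> letter 0 0 0"
abbreviation "hd_letter i \<equiv> letter 1 i 0"
abbreviation "tl_letter i \<equiv> letter 2 i 0"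
abbreviation "half_hd i \<equiv> letter 3 i 0"
abbreviation "half_tl i \<equiv> letter 4 i 0"
abbreviation "probe_hd i j \<equiv> letter 5 i j"
abbreviation "probe_tl i j \<equiv> letter 6 i j"

definition block :: "nat \<Rightarrow> nat \<Rightarrow> nat list" where
  "block n a = a # replicate (n - 1) filler"

lemma length_block [simp]: "0 < n \<Longrightarrow> length (block n a) = n"
  by (simp add: block_def)

lemma hd_block [simp]: "hd (block n a) = a" and hd_block_append [simp]: "hd (block n a @ u) = a"
  by (simp_all add: block_def)

text \<open>
  \<open>n\<close> blocks of length \<open>m\<close>, of which the first is distinguished. The tag system stores a number \<open>n > 0\<close> in
  this form.
\<close>

definition blocks :: "nat \<Rightarrow> nat \<Rightarrow> nat \<Rightarrow> nat \<Rightarrow> nat list" where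
  "blocks m a b n = block m a @ rep (n - 1) (block m b)"

lemma length_blocks: "0 < m \<Longrightarrow> 0 < n \<Longrightarrow> length (blocks m a b n) = m * n"
  by (cases n) (simp_all add: blocks_def)

text \<open>
  Blocks whose first letters record their position. The first letter to be read in such a word
  therefore tells at which block the reading started.
\<close>

definition ladder :: "nat \<Rightarrow> (nat \<Rightarrow> nat) \<Rightarrow> nat \<Rightarrow> nat \<Rightarrow> nat list" where
  "ladder m c i j = concat (map (\<lambda>h. block m (c h)) [i..<j])"

lemma length_ladder: "0 < m \<Longrightarrow> length (ladder m c i j) = m * (j - i)"
  by (simp add: ladder_def length_concat o_def sum_list_triv)

lemma hd_ladder: "i < j \<Longrightarrow> hd (ladder m c i j @ u) = c i"
  by (simp add: ladder_def upt_conv_Cons)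

lemma ladder_split: "i \<le> h \<Longrightarrow> h \<le> j \<Longrightarrow> ladder m c i j = ladder m c i h @ ladder m c h j"
  unfolding ladder_def using upt_add_eq_append[of i h "j - h"] by simp

context counter_machine
begin

text \<open>
  The deletion number is divisible by every prime in use, and \<open>share r\<close> blocks of length one, taken
  \<open>nth_prime r\<close> times, make up one deletion.
\<close>

definition modulus :: nat where "modulus = (\<Prod>r<k. nth_prime r)"

definition share :: "nat \<Rightarrow> nat" where "share r = modulus div nth_prime r"

text \<open>
  The additional prime factor makes the number at least as large as any prime of a counter.
  Otherwise the word could become too short in the middle of a division, and the tag system would
  halt prematurely.
\<close>

definition goedel :: "(nat \<Rightarrow> nat) \<Rightarrow> nat" where
  "goedel s = nth_prime k * (\<Prod>r<k. nth_prime r ^ s r)"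

lemma modulus_pos: "0 < modulus"
  unfolding modulus_def by (rule prod_pos) (simp add: prime_gt_0_nat prime_nth_prime)

lemma modulus_ge_2: "2 \<le> modulus"
proof -
  have "nth_prime 0 dvd modulus" unfolding modulus_def using k_pos by (intro dvd_prodI) auto
  then have "nth_prime 0 \<le> modulus" using modulus_pos by (rule dvd_imp_le)
  then show ?thesis using prime_ge_2_nat[OF prime_nth_prime[of 0]] by simp
qed

lemma share_mult: "r < k \<Longrightarrow> share r * nth_prime r = modulus"
  unfolding share_def modulus_def by (simp add: dvd_prodI)

lemma share_pos: "r < k \<Longrightarrow> 0 < share r"
  using share_mult[of r] modulus_pos by (metis gr0I mult_0)

lemma goedel_split: "r < k \<Longrightarrow> goedel s =
    nth_prime r ^ s r * (nth_prime k * (\<Prod>i\<in>{..<k} - {r}. nth_prime i ^ s i))"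
  unfolding goedel_def by (subst prod.remove[of _ r]) simp_all

lemma goedel_upd: "r < k \<Longrightarrow> goedel (s(r := Suc (s r))) = nth_prime r * goedel s"
  unfolding goedel_split[of r] by simp

lemma goedel_pos: "0 < goedel s"
  unfolding goedel_def by (simp add: prod_pos prime_gt_0_nat prime_nth_prime)

lemma dvd_goedel: "r < k \<Longrightarrow> nth_prime r dvd goedel s \<longleftrightarrow> 0 < s r"
proof
  assume r: "r < k" and dvd: "nth_prime r dvd goedel s"
  show "0 < s r"
  proof (rule ccontr)
    assume "\<not> 0 < s r"
    then have "nth_prime r dvd nth_prime k * (\<Prod>i\<in>{..<k} - {r}. nth_prime i ^ s i)"
      using dvd goedel_split[OF r, of s] by simp
    then consider "nth_prime r dvd nth_prime k" | i where "i < k" "i \<noteq> r" "nth_prime r dvd nth_prime i ^ s i"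
      by (auto simp: prime_dvd_mult_iff[OF prime_nth_prime] prime_dvd_prod_iff[OF _ prime_nth_prime])
    then have "\<exists>i. i \<noteq> r \<and> nth_prime r dvd nth_prime i"
      using r prime_dvd_power[OF prime_nth_prime] by cases (metis less_irrefl, metis)
    then show False using primes_dvd_imp_eq[OF prime_nth_prime prime_nth_prime] nth_prime_eq_iff by metis
  qed
next
  assume "r < k" "0 < s r"
  then show "nth_prime r dvd goedel s"
    unfolding goedel_split[OF \<open>r < k\<close>] by (simp add: dvd_power)
qed

lemma goedel_ge: "r < k \<Longrightarrow> nth_prime r \<le> goedel s"
proof -
  assume "r < k"
  then have "nth_prime r \<le> nth_prime k" using nth_prime_less by (simp add: less_imp_le)
  also have "nth_prime k dvd goedel s" by (simp add: goedel_def)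
  then have "nth_prime k \<le> goedel s" using goedel_pos by (rule dvd_imp_le)
  finally show ?thesis .
qed

text \<open>
  A configuration with instruction \<open>i\<close> and number \<open>N\<close> is \<open>N\<close> full blocks, i.e. blocks whose length is the
  deletion number \<open>v\<close>; the first is headed by \<open>hd_letter i\<close> and the others by \<open>tl_letter i\<close>. A
  pass over full blocks reads each head once.

  Incrementing \<open>r\<close> replaces every block by \<open>p = nth_prime r\<close> blocks.

  Decrementing \<open>r\<close> divides \<open>N\<close> by \<open>p\<close> if this is possible. The full blocks are first replaced by \<open>N\<close> short
  ones, of length \<open>v / p\<close>, so that only every \<open>p\<close>-th of them is read in the next pass. Each block read
  yields a ladder of \<open>p\<close> short blocks, which together have length \<open>v\<close>. If \<open>p\<close> divides \<open>N\<close>, the third pass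
  starts at the bottom of each ladder and reads \<open>N / p\<close> letters with offset \<open>0\<close>, each of which yields one
  full block. If \<open>N\<close> leaves the remainder \<open>d > 0\<close>, the second pass ends with \<open>d\<close> short blocks that are too
  few for a deletion, so the next deletion cuts off the first \<open>p - d\<close> blocks of the first ladder. From
  then on the letters read have the offset \<open>j = p - d\<close>; they restore \<open>N\<close> full blocks. The fillers in front
  of the block of \<open>hd_letter z\<close> are those that the last short deletion removes.
\<close>

fun instr_production :: "instr \<Rightarrow> nat \<Rightarrow> nat \<Rightarrow> nat \<Rightarrow> nat list" where
  "instr_production (Inc r e) t i j =
     (if t = 1 then blocks modulus (hd_letter e) (tl_letter e) (nth_prime r)
      else if t = 2 then rep (nth_prime r) (block modulus (tl_letter e))
      else [])"
| "instr_production (Dec r e z) t i j =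
     (let p = nth_prime r in
      if t = 1 then block (share r) (half_hd i)
      else if t = 2 then block (share r) (half_tl i)
      else if t = 3 then ladder (share r) (probe_hd i) 0 p
      else if t = 4 then ladder (share r) (probe_tl i) 0 p
      else if t = 5 then
        (if j = 0 then block modulus (hd_letter e)
         else replicate (share r * j) filler @ blocks modulus (hd_letter z) (tl_letter z) (p - j))
      else if t = 6 then
        (if j = 0 then block modulus (tl_letter e) else rep p (block modulus (tl_letter z)))
      else [])"

definition letter_production :: "nat \<Rightarrow> nat list" where
  "letter_production a = (let t = fst (prod_decode a); i = fst (prod_decode (snd (prod_decode a)));
     j = snd (prod_decode (snd (prod_decode a)))
   in if i < length P then instr_production (P ! i) t i j else [])"

lemma letter_production: "letter_production (letter t i j) =
    (if i < length P then instr_production (P ! i) t i j else [])"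
  by (simp add: letter_production_def letter_def)

definition letters :: "nat set" where
  "letters = (\<lambda>(t, i, j). letter t i j) ` ({..6} \<times> {..length P} \<times> {..<modulus})"

definition T :: "nat tag_system" where
  "T = \<lparr>deletion = modulus, alphabet = letters, production = letter_production\<rparr>"

lemma T_simps [simp]: "deletion T = modulus" "alphabet T = letters" "production T = letter_production"
  by (simp_all add: T_def)

lemma letter_in_letters [simp]: "letter t i j \<in> letters \<longleftrightarrow> t \<le> 6 \<and> i \<le> length P \<and> j < modulus"
  by (auto simp: letters_def image_iff)

lemma set_block: "set (block n a) \<subseteq> {a, filler}"
  by (auto simp: block_def)

lemma block_in_letters: "a \<in> letters \<Longrightarrow> set (block n a) \<subseteq> letters"
  using set_block[of n a] modulus_pos by auto

lemma nth_prime_le_modulus: "r < k \<Longrightarrow> nth_prime r \<le> modulus"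
  using share_mult[of r] share_pos[of r] by (metis Suc_leI mult_le_mono1 mult_1 One_nat_def)

lemma tag_system_T: "tag_system T"
proof -
  have "set (instr_production (P ! i) t i j) \<subseteq> letters" if i: "i < length P" for t i j
  proof -
    have rep: "set (rep n (block m a)) \<subseteq> letters" if "a \<in> letters" for n m a
      using block_in_letters[OF that] by (auto simp: set_replicate_conv_if)
    have bl: "set (blocks m a b n) \<subseteq> letters" if "a \<in> letters" "b \<in> letters" for m a b n
      using block_in_letters[OF that(1)] rep[OF that(2)] unfolding blocks_def by auto
    have la: "set (ladder m (letter t i) 0 p) \<subseteq> letters" if "p \<le> modulus" "t \<le> 6" for m t p
    proof -
      have "set (block m (letter t i h)) \<subseteq> letters" if "h < p" for h
        using that \<open>p \<le> modulus\<close> \<open>t \<le> 6\<close> i by (intro block_in_letters) simp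
      then show ?thesis by (fastforce simp: ladder_def)
    qed
    have p: "nth_prime (reg (P ! i)) \<le> modulus" using reg_less[OF i] by (rule nth_prime_le_modulus)
    have sub: "set (replicate m filler @ u) \<subseteq> letters" if "set u \<subseteq> letters" for u m
      using that modulus_pos by (auto simp: set_replicate_conv_if)
    have tgt: "e \<in> targets (P ! i) \<Longrightarrow> t \<le> 6 \<Longrightarrow> letter t e 0 \<in> letters" for e t
      using target_le[OF i] modulus_pos by simp
    have ii: "t \<le> 6 \<Longrightarrow> letter t i 0 \<in> letters" for t using i modulus_pos by simp
    show ?thesis
    proof (cases "P ! i")
      case (Inc r e)
      have e: "letter t e 0 \<in> letters" if "t \<le> 6" for t using tgt[of e] Inc that by simp
      have "set (rep (nth_prime r) (block modulus (tl_letter e))) \<subseteq> letters" by (rule rep[OF e]) simp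
      then show ?thesis unfolding Inc instr_production.simps
        using bl[OF e e, of 1 2] by (auto simp del: set_concat)
    next
      case (Dec r e z)
      have e: "letter t e 0 \<in> letters" if "t \<le> 6" for t using tgt[of e] Dec that by simp
      have z: "letter t z 0 \<in> letters" if "t \<le> 6" for t using tgt[of z] Dec that by simp
      have "set (rep (nth_prime r) (block modulus (tl_letter z))) \<subseteq> letters" by (rule rep[OF z]) simp
      moreover have "set (block modulus (hd_letter e)) \<subseteq> letters" "set (block modulus (tl_letter e)) \<subseteq> letters"
        by (rule block_in_letters[OF e]; simp)+
      ultimately show ?thesis unfolding Dec instr_production.simps Let_def
        using sub[OF bl[OF z z, of 1 2]]
          la[OF p, of 5] la[OF p, of 6] block_in_letters[OF ii, of 3] block_in_letters[OF ii, of 4] Dec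
        by (auto simp del: set_concat set_append)
    qed
  qed
  then have "set (letter_production (letter t i j)) \<subseteq> letters" for t i j
    by (cases "i < length P") (simp_all add: letter_production)
  then have "letter_production a \<in> lists letters" if a: "a \<in> letters" for a
  proof -
    obtain t i j where "a = letter t i j" using a unfolding letters_def by force
    then show ?thesis using \<open>\<And>t i j. set (letter_production (letter t i j)) \<subseteq> letters\<close>
      unfolding lists_eq_set by blast
  qed
  moreover have "finite letters" by (simp add: letters_def)
  ultimately show ?thesis using modulus_ge_2 by (simp add: tag_system_def)
qed

definition tag_word :: "nat \<times> (nat \<Rightarrow> nat) \<Rightarrow> nat list" where
  "tag_word c = blocks modulus (hd_letter (fst c)) (tl_letter (fst c)) (goedel (snd c))"

abbreviation "tag_steps \<equiv> (\<lambda>x y. tag_next T x = Some y)\<^sup>*\<^sup>*"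
abbreviation "tag_moves \<equiv> (\<lambda>x y. tag_next T x = Some y)\<^sup>+\<^sup>+"

lemma full_pass:
  "tag_moves (blocks modulus a b n) (letter_production a @ rep (n - 1) (letter_production b))"
proof -
  let ?ws = "replicate (n - 1) (block modulus b)"
  have "tag_next T (blocks modulus a b n) = Some (concat ?ws @ letter_production a)"
    using modulus_pos by (simp add: tag_next_def tag_nonhalting_def tag_step_def blocks_def)
  moreover have "tag_steps (concat ?ws @ letter_production a) (letter_production a @ rep (n - 1) (letter_production b))"
    using tag_pass[of ?ws T "letter_production a"] modulus_pos by (simp add: map_replicate)
  ultimately show ?thesis by (rule rtranclp_into_tranclp2)
qed

lemma group_pass:
  assumes "u \<noteq> []" "length u = modulus" "length w = modulus"
  shows "tag_steps (u @ rep m w @ rest) (rest @ letter_production (hd u) @ rep m (letter_production (hd w)))"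
  using tag_pass[of "u # replicate m w" T rest] modulus_pos assms by (simp add: map_replicate)

lemma tag_step_Inc:
  assumes "i < length P" "P ! i = Inc r e"
  shows "tag_moves (tag_word (i, s)) (tag_word (e, s(r := Suc (s r))))"
proof -
  have r: "r < k" using reg_less[OF assms(1)] assms(2) by simp
  let ?p = "nth_prime r" and ?N = "goedel s"
  have p: "0 < ?p" by (simp add: prime_gt_0_nat prime_nth_prime)
  have "?p - 1 + (?N - 1) * ?p = ?p * ?N - 1"
    using goedel_pos[of s] p by (cases ?N) (auto simp: algebra_simps)
  then have "rep (?p - 1) w @ rep (?N - 1) (rep ?p w) = rep (?p * ?N - 1) w" for w :: "nat list"
    unfolding rep_mult by (metis rep_add)
  then show ?thesis
    using full_pass[of "hd_letter i" "tl_letter i" ?N] assms goedel_upd[OF r, of s]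
    by (simp add: tag_word_def letter_production blocks_def)
qed

lemma tag_step_Dec_halve:
  assumes "i < length P" "P ! i = Dec r e z"
  shows "tag_moves (tag_word (i, s)) (blocks (share r) (half_hd i) (half_tl i) (goedel s))"
  using full_pass[of "hd_letter i" "tl_letter i" "goedel s"] assms
  by (simp add: tag_word_def letter_production blocks_def)

text \<open>
  The second pass of a division: \<open>d\<close> short blocks are left over in front of the ladders.
\<close>

lemma tag_step_Dec_probe:
  assumes "i < length P" "P ! i = Dec r e z" "0 < m"
  shows "tag_steps (blocks (share r) (half_hd i) (half_tl i) (nth_prime r * m + d))
    (rep d (block (share r) (half_tl i)) @ ladder (share r) (probe_hd i) 0 (nth_prime r) @
      rep (m - 1) (ladder (share r) (probe_tl i) 0 (nth_prime r)))"
proof -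
  have r: "r < k" using reg_less[OF assms(1)] assms(2) by simp
  let ?p = "nth_prime r" and ?h = "half_hd i" and ?t = "half_tl i"
  have p: "0 < ?p" by (simp add: prime_gt_0_nat prime_nth_prime)
  have "?p * m + d - 1 = ?p - 1 + ((m - 1) * ?p + d)"
    using assms(3) p by (cases m) (auto simp: algebra_simps)
  then have "blocks (share r) ?h ?t (?p * m + d) =
     blocks (share r) ?h ?t ?p @ rep (m - 1) (rep ?p (block (share r) ?t)) @ rep d (block (share r) ?t)"
    unfolding blocks_def rep_mult by (simp add: replicate_add)
  moreover have "length (blocks (share r) ?h ?t ?p) = modulus" "length (rep ?p (block (share r) ?t)) = modulus"
    using share_pos[OF r] share_mult[OF r] p by (simp_all add: length_blocks mult.commute)
  moreover have "hd (blocks (share r) ?h ?t ?p) = ?h" by (simp add: blocks_def)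
  moreover have "hd (rep ?p (block (share r) ?t)) = ?t" using p by (cases ?p) auto
  ultimately show ?thesis
    using group_pass[of "blocks (share r) ?h ?t ?p" "rep ?p (block (share r) ?t)" "m - 1" "rep d (block (share r) ?t)"]
      assms by (simp add: letter_production Let_def) (simp add: blocks_def block_def)
qed

lemma tag_step_Dec_positive:
  assumes i: "i < length P" "P ! i = Dec r e z" and s: "s r = Suc n"
  shows "tag_moves (tag_word (i, s)) (tag_word (e, s(r := n)))"
proof -
  have r: "r < k" using reg_less[OF i(1)] i(2) by simp
  let ?p = "nth_prime r" and ?m = "goedel (s(r := n))"
  have p: "0 < ?p" by (simp add: prime_gt_0_nat prime_nth_prime)
  have "goedel s = ?p * ?m" using goedel_upd[OF r, of "s(r := n)"] s by (simp add: fun_upd_idem)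
  then have 1: "tag_moves (tag_word (i, s)) (ladder (share r) (probe_hd i) 0 ?p @
      rep (?m - 1) (ladder (share r) (probe_tl i) 0 ?p))"
    using tranclp_rtranclp_tranclp[OF tag_step_Dec_halve[OF i, of s]] tag_step_Dec_probe[OF i goedel_pos, of "s(r := n)" 0]
    by simp
  have len: "length (ladder (share r) c 0 ?p) = modulus" for c
    using share_pos[OF r] share_mult[OF r] by (simp add: length_ladder)
  then have ne: "ladder (share r) c 0 ?p \<noteq> []" for c using modulus_pos by (metis length_0_conv less_irrefl)
  have hd: "hd (ladder (share r) c 0 ?p) = c 0" for c using hd_ladder[OF p, of _ _ "[]"] by simp
  have "tag_steps (ladder (share r) (probe_hd i) 0 ?p @ rep (?m - 1) (ladder (share r) (probe_tl i) 0 ?p))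
     (tag_word (e, s(r := n)))"
    using group_pass[OF ne len len, of "probe_hd i" "?m - 1" "probe_tl i" "[]"] i
    by (simp add: hd letter_production Let_def tag_word_def blocks_def)
  with 1 show ?thesis by (rule tranclp_rtranclp_tranclp)
qed

text \<open>
  With \<open>N = p m + d\<close> and \<open>0 < d < p\<close>, let every ladder be cut after its first \<open>j = p - d\<close> blocks into \<open>U1 @ U2\<close>
  (the first ladder) or \<open>W1 @ W2\<close> (the others). The left-over blocks and \<open>U1\<close> are consumed by one
  deletion, which adds one more ladder; then the pieces \<open>U2 @ W1\<close> and \<open>W2 @ W1\<close> are read at
  offset \<open>j\<close>, and the last \<open>W2\<close> is consumed together with the fillers that were produced for this
  purpose. The numbers of blocks produced are \<open>d\<close>, \<open>(m - 1) p\<close> and \<open>p\<close>, which add up to \<open>N\<close>. That \<open>m\<close> is positive keeps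
  the word long enough for all these deletions.
\<close>

lemma tag_step_Dec_zero:
  assumes i: "i < length P" "P ! i = Dec r e z" and s: "s r = 0"
  shows "tag_moves (tag_word (i, s)) (tag_word (z, s))"
proof -
  have r: "r < k" using reg_less[OF i(1)] i(2) by simp
  let ?p = "nth_prime r" and ?c = "share r"
  define m d where "m = goedel s div ?p" and "d = goedel s mod ?p"
  define j where "j = ?p - d"
  let ?u = "probe_hd i" and ?w = "probe_tl i" and ?b = "block modulus (tl_letter z)"
  have p: "0 < ?p" by (simp add: prime_gt_0_nat prime_nth_prime)
  have N: "goedel s = ?p * m + d" by (simp add: m_def d_def)
  have m: "0 < m" using goedel_ge[OF r, of s] p by (simp add: m_def div_greater_zero_iff)
  have d: "0 < d" "d < ?p" using dvd_goedel[OF r, of s] s p by (simp_all add: d_def mod_greater_zero_iff_not_dvd)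
  then have j: "0 < j" "j < ?p" "j \<le> ?p" "?p - j = d" by (auto simp: j_def)
  have c: "0 < ?c" "?c * d + ?c * j = modulus"
    using share_pos[OF r] share_mult[OF r] d by (simp_all add: j_def flip: distrib_left)
  let ?W1 = "ladder ?c ?w 0 j" and ?W2 = "ladder ?c ?w j ?p"
  let ?U1 = "ladder ?c ?u 0 j" and ?U2 = "ladder ?c ?u j ?p"
  note len = length_ladder[OF c(1)]
  note prod = letter_production Let_def i j
  have 1: "tag_moves (tag_word (i, s)) (rep d (block ?c (half_tl i)) @ (?U1 @ ?U2) @ rep (m - 1) (?W1 @ ?W2))"
    using tranclp_rtranclp_tranclp[OF tag_step_Dec_halve[OF i, of s]] tag_step_Dec_probe[OF i m, of d]
    by (simp add: N ladder_split[of 0 j ?p] j)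
  have hd1: "hd (rep d (block ?c (half_tl i)) @ ?U1) = half_tl i"
    using d by (cases d) auto
  have len1: "length (rep d (block ?c (half_tl i)) @ ?U1) = modulus"
    using c by (simp add: len mult.commute)
  have 2: "tag_steps ((rep d (block ?c (half_tl i)) @ ?U1) @ ?U2 @ rep (m - 1) (?W1 @ ?W2))
      ((?U2 @ rep (m - 1) (?W1 @ ?W2)) @ (?W1 @ ?W2))"
    using tag_pass[of "[rep d (block ?c (half_tl i)) @ ?U1]" T "?U2 @ rep (m - 1) (?W1 @ ?W2)"] len1 modulus_pos
    unfolding list.map hd1 by (simp add: prod ladder_split[of 0 j ?p])
  have "rep m (?W1 @ ?W2) = ?W1 @ rep (m - 1) (?W2 @ ?W1) @ ?W2"
    using rep_rotate[of "m - 1" ?W1 ?W2] m by simp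
  moreover have "rep (m - 1) (?W1 @ ?W2) @ ?W1 @ ?W2 = rep m (?W1 @ ?W2)"
    using rep_add[of "m - 1" 1 "?W1 @ ?W2"] m by simp
  ultimately have eq2: "(?U2 @ rep (m - 1) (?W1 @ ?W2)) @ (?W1 @ ?W2) = (?U2 @ ?W1) @ rep (m - 1) (?W2 @ ?W1) @ ?W2"
    by simp
  have len2: "length (?U2 @ ?W1) = modulus" "length (?W2 @ ?W1) = modulus"
    using c j by (simp_all add: len)
  have "?U2 @ ?W1 \<noteq> []" using len2(1) modulus_pos by (metis length_0_conv less_irrefl)
  from group_pass[OF this len2, of "m - 1" ?W2]
  have 3: "tag_steps ((?U2 @ ?W1) @ rep (m - 1) (?W2 @ ?W1) @ ?W2)
      ((?W2 @ replicate (?c * j) filler) @ blocks modulus (hd_letter z) (tl_letter z) d @ rep (m - 1) (rep ?p ?b))"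
    unfolding hd_ladder[OF j(2)] using j by (simp add: prod)
  have "length (?W2 @ replicate (?c * j) filler) = modulus" using c j by (simp add: len)
  moreover have "hd (?W2 @ replicate (?c * j) filler) = probe_tl i j" by (rule hd_ladder[OF j(2)])
  ultimately have 4: "tag_steps ((?W2 @ replicate (?c * j) filler) @ blocks modulus (hd_letter z) (tl_letter z) d @ rep (m - 1) (rep ?p ?b))
      ((blocks modulus (hd_letter z) (tl_letter z) d @ rep (m - 1) (rep ?p ?b)) @ rep ?p ?b)"
    using tag_pass[of "[?W2 @ replicate (?c * j) filler]" T
        "blocks modulus (hd_letter z) (tl_letter z) d @ rep (m - 1) (rep ?p ?b)"] modulus_pos j
    unfolding list.map by (simp add: prod)
  have "rep (d - 1) ?b @ rep (m - 1) (rep ?p ?b) @ rep ?p ?b = rep (goedel s - 1) ?b"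
  proof -
    have "goedel s - 1 = (d - 1) + ((m - 1) * ?p + ?p)" using N m d by (cases m) (auto simp: algebra_simps)
    then show ?thesis unfolding rep_mult by (simp only: rep_add)
  qed
  then have eq4: "(blocks modulus (hd_letter z) (tl_letter z) d @ rep (m - 1) (rep ?p ?b)) @ rep ?p ?b = tag_word (z, s)"
    by (simp add: tag_word_def blocks_def)
  have "tag_steps ((?U2 @ ?W1) @ rep (m - 1) (?W2 @ ?W1) @ ?W2) (tag_word (z, s))"
    using rtranclp_trans[OF 3 4] unfolding eq4 .
  with 2 have "tag_steps ((rep d (block ?c (half_tl i)) @ ?U1) @ ?U2 @ rep (m - 1) (?W1 @ ?W2)) (tag_word (z, s))"
    unfolding eq2 by (rule rtranclp_trans)
  with 1 show ?thesis unfolding append_assoc by (rule tranclp_rtranclp_tranclp)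
qed

lemma tag_word_step:
  assumes "counter_step P c = Some d"
  shows "tag_moves (tag_word c) (tag_word d)"
proof -
  obtain i s where c: "c = (i, s)" by fastforce
  have i: "i < length P" using assms c by (auto split: if_splits)
  show ?thesis
  proof (cases "P ! i")
    case (Inc r e)
    then show ?thesis using tag_step_Inc[OF i Inc, of s] assms c i by auto
  next
    case (Dec r e z)
    then show ?thesis
      using tag_step_Dec_zero[OF i Dec] tag_step_Dec_positive[OF i Dec] assms c i
      by (cases "s r") auto
  qed
qed

lemma tag_word_halt:
  assumes "counter_step P c = None"
  shows "\<exists>w. runs (tag_next T) (tag_word c) w"
proof -
  obtain i s where c: "c = (i, s)" by fastforce
  have i: "\<not> i < length P" using assms c by (auto split: if_splits instr.splits)
  have "tag_moves (tag_word c) []"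
    using full_pass[of "hd_letter i" "tl_letter i" "goedel s"] i
    by (simp add: c tag_word_def letter_production)
  moreover have "tag_next T [] = None"
    using modulus_pos by (simp add: tag_next_def tag_nonhalting_def)
  ultimately show ?thesis unfolding runs_def by (auto intro: tranclp_into_rtranclp)
qed

theorem tag_halts_tag_word:
  "tag_halts T (tag_word c) \<longleftrightarrow> (\<exists>d. runs (counter_step P) c d)"
proof -
  note simulation = runs_simulation[where Sim = "\<lambda>c w. w = tag_word c" and f = "counter_step P" and
      g = "tag_next T" and Q = "\<lambda>_ _. True"]
  have step: "\<exists>v. tag_moves w v \<and> v = tag_word d" if "w = tag_word c" "counter_step P c = Some d" for c d w
    using tag_word_step that by blast
  have halt: "\<exists>v. runs (tag_next T) w v \<and> True" if "w = tag_word c" "counter_step P c = None" for c w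
    using tag_word_halt that by blast
  show ?thesis unfolding tag_halts_iff_runs
  proof
    assume "\<exists>w. runs (tag_next T) (tag_word c) w"
    then obtain w where w: "runs (tag_next T) (tag_word c) w" ..
    have "\<exists>d. runs (counter_step P) c d \<and> True"
      by (rule simulation(2)[OF _ _ refl w]) (fact step halt)+
    then show "\<exists>d. runs (counter_step P) c d" by simp
  next
    assume "\<exists>d. runs (counter_step P) c d"
    then obtain d where d: "runs (counter_step P) c d" ..
    have "\<exists>w. runs (tag_next T) (tag_word c) w \<and> True"
      by (rule simulation(1)[OF _ _ refl d]) (fact step halt)+
    then show "\<exists>w. runs (tag_next T) (tag_word c) w" by simp
  qed
qed

lemma tag_word_in_words: "tag_word (0, s) \<in> tag_words T"
proof -
  have "set (block modulus (letter t 0 0)) \<subseteq> letters" if "t \<le> 6" for t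
    using that modulus_pos by (intro block_in_letters) simp
  from this[of 1] this[of 2] show ?thesis
    unfolding tag_word_def blocks_def by (auto simp: set_replicate_conv_if split: if_splits)
qed

lemma goedel_input: "goedel (input_registers n) = nth_prime k * nth_prime 0 ^ n"
proof -
  have "(\<Prod>r\<in>{..<k} - {0}. nth_prime r ^ input_registers n r) = 1"
    by (rule prod.neutral) (simp add: input_registers_def)
  then show ?thesis using goedel_split[OF k_pos, of "input_registers n"] by (simp add: input_registers_def)
qed

lemma computable_tag_word:
  "computable_on list_encode list_encode A (\<lambda>x. tag_word (0, input_registers (length x)))"
proof -
  let ?h = "block modulus (hd_letter 0)" and ?t = "block modulus (tl_letter 0)"
  let ?f = "\<lambda>n. list_encode (?h @ list_decode (rec_nat 0 (\<lambda>k r. list_encode (?t @ list_decode r))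
     (nth_prime k * nth_prime 0 ^ length (list_decode n) - 1)))"
  have "rec_nat 0 (\<lambda>k r. list_encode (?t @ list_decode r)) m = list_encode (rep m ?t)" for m
    by (induction m) simp_all
  then have "?f (list_encode x) = list_encode (tag_word (0, input_registers (length x)))" for x
    by (simp add: tag_word_def blocks_def goedel_input)
  moreover have "total_recursive 1 (\<lambda>xs. ?f (xs ! 0))"
    by (intro total_recursive_append_code total_recursive_rec_nat recs) simp_all
  ultimately show ?thesis by (intro computable_onI[where f = ?f])
qed

end

text \<open>
  The machine and the tag system simulate the same counter program from the same counters, so
  that one halts iff the other does, on every word over the alphabet of the machine.
\<close>

theorem ex_universal_tag_system: "\<exists>T. universal_tag_system T"
proof -
  obtain P k where program: "counter_program P k"
    and halts: "\<And>x y. runs (orbit tm_step_code) x y \<Longrightarrow>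
       runs (counter_step P) (0, input_registers x) (length P, input_registers y)"
    and loops: "\<And>x c. runs (counter_step P) (0, input_registers x) c \<Longrightarrow> \<exists>y. runs (orbit tm_step_code) x y"
    using orbit_counter_program[OF total_recursive_tm_step_code] by metis
  interpret counter_machine P k by unfold_locales (rule program)
  have inputs: "replicate n 1 \<in> tm_inputs U" for n
    using one_in_alphabet by (auto simp: tm_inputs_def)
  have "universal_tm U"
  proof (rule universal_tmI[OF one_in_alphabet])
    show "tm_computes U (replicate x 1) (replicate y 1)" if "runs (orbit tm_step_code) x y" for x y
      using counter_tm_computes(1)[OF inputs, of x] halts[OF that] by simp
    show "\<exists>y. runs (orbit tm_step_code) x y" if "tm_halts U (replicate x 1)" for x
      using counter_tm_computes(2)[OF inputs, of x] loops that by simp blast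
  qed
  moreover have "tm_halts U x \<longleftrightarrow> tag_halts T (tag_word (0, input_registers (length x)))"
    if "x \<in> tm_inputs U" for x
    using counter_tm_computes(2)[OF that] tag_halts_tag_word by simp
  ultimately have "universal_tag_system T"
    unfolding universal_tag_system_def
    using tag_system_T computable_tag_word tag_word_in_words by blast
  then show ?thesis ..
qed


section \<open>Real functions denoted by constant-free terms\<close>

text \<open>
  \<open>Ln (-1) = \<i> \<pi>\<close>, so \<open>(-1)\<close> to the power \<open>y\<close> lies on the unit circle at the angle \<open>\<pi> y\<close>, and the principal
  logarithm reduces this angle to \<open>(-\<pi>, \<pi>]\<close>. The right-hand side is the representative of \<open>y\<close> modulo \<open>2\<close>
  in \<open>(-1, 1]\<close>.
\<close>

lemma Ln_minus_one_powr:
  "Ln ((-1) powr of_real y) / Ln (-1) = of_real (y - 2 * of_int \<lceil>(y - 1) / 2\<rceil>)"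
proof -
  define n where "n = \<lceil>(y - 1) / 2\<rceil>"
  define z where "z = y - 2 * of_int n"
  have "real_of_int n - 1 < (y - 1) / 2" "(y - 1) / 2 \<le> real_of_int n"
    using ceiling_correct[of "(y - 1) / 2"] unfolding n_def by simp_all
  then have z: "-1 < z" "z \<le> 1" unfolding z_def by (simp_all add: field_simps)
  have "((-1) :: complex) powr of_real y = exp (\<i> * of_real (pi * z) + \<i> * (of_int n * (of_real pi * 2)))"
    by (simp add: powr_def z_def algebra_simps)
  also have "\<dots> = exp (\<i> * of_real (pi * z))"
    by (rule exp_plus_2pin)
  also have "Ln \<dots> = \<i> * of_real (pi * z)"
    using mult_strict_left_mono[OF z(1) pi_gt_zero] mult_left_mono[OF z(2) pi_ge_zero]
    by (intro Ln_exp) auto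
  finally show ?thesis by (simp add: z_def n_def)
qed

definition denotes :: "real set \<Rightarrow> lexp \<Rightarrow> (real \<Rightarrow> real) \<Rightarrow> bool" where
  "denotes D t f \<longleftrightarrow> constant_free t \<and> lexp_vars t = {0} \<and>
     (\<forall>x\<in>D. lexp_map t (of_real x) = Some (of_real (f x)))"

definition expressible :: "real set \<Rightarrow> (real \<Rightarrow> real) \<Rightarrow> bool" where
  "expressible D f \<longleftrightarrow> (\<exists>t. denotes D t f)"

lemma expressible_cong:
  assumes "expressible D f" "\<And>x. x \<in> D \<Longrightarrow> f x = g x"
  shows "expressible D g"
proof -
  have "denotes D t g" if "denotes D t f" for t
    using that assms(2) by (simp add: denotes_def)
  then show ?thesis using assms(1) unfolding expressible_def by blast
qed

lemma expressible_var: "expressible D (\<lambda>x. x)"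
  unfolding expressible_def denotes_def by (intro exI[of _ "Var 0"]) (simp add: lexp_map_def)

lemma expressible_powr:
  assumes "expressible D f" "expressible D g" "\<And>x. x \<in> D \<Longrightarrow> 0 < f x"
  shows "expressible D (\<lambda>x. f x powr g x)"
proof -
  obtain s t where st: "denotes D s f" "denotes D t g"
    using assms(1,2) unfolding expressible_def by blast
  have "lexp_map (Pow s t) (of_real x) = Some (of_real (f x powr g x))" if "x \<in> D" for x
    using st assms(3)[OF that] that by (simp add: denotes_def lexp_map_def powr_of_real)
  then show ?thesis unfolding expressible_def denotes_def using st[unfolded denotes_def] by (intro exI[of _ "Pow s t"]) simp
qed

lemma expressible_ln:
  assumes "expressible D f" "expressible D g"
    "\<And>x. x \<in> D \<Longrightarrow> 0 < f x \<and> f x \<noteq> 1" "\<And>x. x \<in> D \<Longrightarrow> 0 < g x"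
  shows "expressible D (\<lambda>x. ln (g x) / ln (f x))"
proof -
  obtain s t where st: "denotes D s f" "denotes D t g"
    using assms(1,2) unfolding expressible_def by blast
  have "lexp_map (Log s t) (of_real x) = Some (of_real (ln (g x) / ln (f x)))" if "x \<in> D" for x
    using st assms(3,4)[OF that] that by (simp add: denotes_def lexp_map_def Ln_of_real)
  then show ?thesis unfolding expressible_def denotes_def using st[unfolded denotes_def] by (intro exI[of _ "Log s t"]) simp
qed

text \<open>
  On numbers above 1 all the logarithms to base \<open>x\<close> below are real and defined, and \<open>x\<close> to a real
  power is positive, so that the terms for the field operations stay away from the branch cut.
\<close>

locale above_one =
  fixes D :: "real set"
  assumes gt_1: "x \<in> D \<Longrightarrow> 1 < x"
begin

lemma base: "x \<in> D \<Longrightarrow> 0 < x" "x \<in> D \<Longrightarrow> ln x \<noteq> 0" "x \<in> D \<Longrightarrow> x \<noteq> 1" "x \<in> D \<Longrightarrow> x \<noteq> 0"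
  using gt_1[of x] by auto

lemma expressible_mult:
  assumes "expressible D f" "expressible D g"
  shows "expressible D (\<lambda>x. f x * g x)"
proof (rule expressible_cong)
  show "expressible D (\<lambda>x. ln ((x powr f x) powr g x) / ln x)"
    using base by (intro expressible_ln expressible_powr expressible_var assms) auto
qed (use base in \<open>auto simp: ln_powr\<close>)

lemma expressible_add:
  assumes "expressible D f" "expressible D g"
  shows "expressible D (\<lambda>x. f x + g x)"
proof (rule expressible_cong)
  show "expressible D (\<lambda>x. ln (x powr f x * x powr g x) / ln x)"
    using base by (intro expressible_ln expressible_mult expressible_powr expressible_var assms) (auto intro!: mult_pos_pos)
qed (use base in \<open>auto simp: ln_powr simp flip: powr_add\<close>)

lemma expressible_divide:
  assumes "expressible D f" "expressible D g" "\<And>x. x \<in> D \<Longrightarrow> g x \<noteq> 0"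
  shows "expressible D (\<lambda>x. f x / g x)"
proof (rule expressible_cong)
  show "expressible D (\<lambda>x. ln (x powr f x) / ln (x powr g x))"
    using base assms(3) by (intro expressible_ln expressible_powr expressible_var assms(1,2)) auto
qed (use base in \<open>auto simp: ln_powr\<close>)

lemma expressible_one: "expressible D (\<lambda>x. 1)"
proof (rule expressible_cong)
  show "expressible D (\<lambda>x. ln x / ln x)"
    using base by (intro expressible_ln expressible_var) auto
qed (use base in auto)

lemma expressible_zero: "expressible D (\<lambda>x. 0)"
proof (rule expressible_cong)
  show "expressible D (\<lambda>x. ln 1 / ln x)"
    using base by (intro expressible_ln expressible_var expressible_one) auto
qed auto

lemma expressible_minus_one: "expressible D (\<lambda>x. -1)"
proof (rule expressible_cong)
  show "expressible D (\<lambda>x. ln x / ln (1 / x))"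
    using base by (intro expressible_ln expressible_var expressible_divide expressible_one) auto
qed (use base in \<open>auto simp: ln_div\<close>)

lemma expressible_diff:
  assumes "expressible D f" "expressible D g"
  shows "expressible D (\<lambda>x. f x - g x)"
  using expressible_add[OF assms(1) expressible_mult[OF expressible_minus_one assms(2)]] by simp

lemma expressible_of_nat: "expressible D (\<lambda>x. real n)"
proof (induction n)
  case (Suc n)
  from expressible_add[OF this expressible_one] show ?case by (simp add: add.commute)
qed (simp add: expressible_zero)

text \<open>
  The only place where the branch cut is used. With \<open>y = 1 - 2 u\<close>, the representative of \<open>y\<close> modulo 2
  differs from \<open>y\<close> by twice the floor of \<open>u\<close>.
\<close>

lemma expressible_floor:
  assumes "expressible D f"
  shows "expressible D (\<lambda>x. of_int \<lfloor>f x\<rfloor>)"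
proof (rule expressible_cong)
  let ?y = "\<lambda>x. 1 - (1 + 1) * f x"
  have y: "expressible D ?y" by (intro expressible_diff expressible_mult expressible_add expressible_one assms)
  obtain s t where st: "denotes D s (\<lambda>x. -1)" "denotes D t ?y"
    using expressible_minus_one y unfolding expressible_def by blast
  have y': "expressible D (\<lambda>x. ?y x - 2 * of_int \<lceil>(?y x - 1) / 2\<rceil>)"
    unfolding expressible_def denotes_def
  proof (intro exI[of _ "Log s (Pow s t)"] conjI ballI)
    fix x assume "x \<in> D"
    then have "lexp_map (Log s (Pow s t)) (of_real x) = Some (Ln ((-1) powr of_real (?y x)) / Ln (-1))"
      using st by (simp add: denotes_def lexp_map_def)
    then show "lexp_map (Log s (Pow s t)) (of_real x) = Some (of_real (?y x - 2 * of_int \<lceil>(?y x - 1) / 2\<rceil>))"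
      by (simp only: Ln_minus_one_powr)
  qed (use st in \<open>auto simp: denotes_def\<close>)
  show "expressible D (\<lambda>x. ((?y x - 2 * of_int \<lceil>(?y x - 1) / 2\<rceil>) - ?y x) / (1 + 1))"
    by (intro expressible_divide expressible_diff[OF y' y] expressible_add expressible_one) auto
  show "((?y x - 2 * of_int \<lceil>(?y x - 1) / 2\<rceil>) - ?y x) / (1 + 1) = of_int \<lfloor>f x\<rfloor>" for x
    by (simp add: ceiling_def)
qed

lemma expressible_sum:
  fixes n :: nat
  assumes "\<And>e. e < n \<Longrightarrow> expressible D (f e)"
  shows "expressible D (\<lambda>x. \<Sum>e<n. f e x)"
  using assms
proof (induction n)
  case (Suc n)
  from expressible_add[OF Suc.IH Suc.prems[of n]] Suc.prems show ?case by simp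
qed (simp add: expressible_zero)

text \<open>
  For integers \<open>d\<close> and \<open>e\<close> the floor of \<open>1 / (1 + (d - e)^2)\<close> is 1 if \<open>d = e\<close> and 0 otherwise.
\<close>

lemma expressible_tabulate:
  fixes f :: "nat \<Rightarrow> nat" and h :: "real \<Rightarrow> real"
  assumes h: "expressible D h" and K: "\<And>x. x \<in> D \<Longrightarrow> \<exists>e<K. h x = real e"
  shows "expressible D (\<lambda>x. real (f (nat \<lfloor>h x\<rfloor>)))"
proof (rule expressible_cong)
  let ?I = "\<lambda>e x. of_int \<lfloor>1 / (1 + (h x - real e) * (h x - real e))\<rfloor> :: real"
  have pos: "1 + (a - b) * (a - b) \<noteq> 0" for a b :: real
    using zero_le_square[of "a - b"] by linarith
  show "expressible D (\<lambda>x. \<Sum>e<K. real (f e) * ?I e x)"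
    by (intro expressible_sum expressible_mult expressible_floor expressible_divide expressible_diff expressible_add expressible_one h expressible_of_nat pos)
  fix x assume "x \<in> D"
  then obtain d where d: "d < K" "h x = real d" using K by blast
  have "?I e x = (if e = d then 1 else 0)" for e
  proof (cases "e = d")
    case False
    then have "1 \<le> \<bar>real d - real e\<bar>" by linarith
    then have "1 \<le> (real d - real e) * (real d - real e)"
      by (metis abs_mult_self_eq mult_mono' mult_1 zero_le_one)
    then have "\<lfloor>1 / (1 + (real d - real e) * (real d - real e))\<rfloor> = 0"
      by (simp add: floor_eq_iff add_pos_pos)
    then show ?thesis using d False by simp
  qed (use d in simp)
  then have "(\<Sum>e<K. real (f e) * ?I e x) = (\<Sum>e<K. if e = d then real (f e) else 0)"
    by (intro sum.cong) auto
  also have "\<dots> = real (f d)" using d(1) by simp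
  finally show "(\<Sum>e<K. real (f e) * ?I e x) = real (f (nat \<lfloor>h x\<rfloor>))" using d(2) by simp
qed

end

section \<open>Tag steps as log--exp terms\<close>

text \<open>
  The digits are the letters plus one: a zero digit at the front would be lost.
\<close>

definition word_code :: "nat \<Rightarrow> nat list \<Rightarrow> nat" where
  "word_code B = foldl (\<lambda>c a. c * B + Suc a) 0"

lemma word_code_Nil [simp]: "word_code B [] = 0"
  and word_code_snoc [simp]: "word_code B (w @ [a]) = word_code B w * B + Suc a"
  by (simp_all add: word_code_def)

lemma word_code_append: "word_code B (u @ w) = word_code B u * B ^ length w + word_code B w"
proof (induction w rule: rev_induct)
  case (snoc a w)
  have "word_code B (u @ w @ [a]) = word_code B (u @ w) * B + Suc a"
    using word_code_snoc[of B "u @ w" a] by simp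
  then show ?case using snoc by (simp add: algebra_simps)
qed simp

lemma word_code_Cons: "word_code B (a # w) = Suc a * B ^ length w + word_code B w"
  using word_code_append[of B "[a]" w] by (simp add: word_code_def)

lemma word_code_less:
  assumes "\<forall>a\<in>set w. Suc a < B"
  shows "word_code B w < B ^ length w"
  using assms
proof (induction w)
  case (Cons a w)
  then have "word_code B (a # w) < Suc (Suc a) * B ^ length w" by (simp add: word_code_Cons)
  also have "\<dots> \<le> B * B ^ length w" using Cons.prems by (intro mult_le_mono1) auto
  finally show ?case by simp
qed simp

lemma word_code_inj:
  assumes "\<forall>a\<in>set u. Suc a < B" "\<forall>a\<in>set w. Suc a < B" "word_code B u = word_code B w"
  shows "u = w"
  using assms
proof (induction u arbitrary: w rule: rev_induct)
  case Nil
  then show ?case by (cases w rule: rev_cases) auto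
next
  case (snoc a u)
  then obtain b z where w: "w = z @ [b]" by (cases w rule: rev_cases) auto
  have eq: "word_code B u * B + Suc a = word_code B z * B + Suc b" using snoc.prems w by simp
  have lt: "Suc a < B" "Suc b < B" using snoc.prems w by auto
  then have "a = b" using arg_cong[OF eq, of "\<lambda>n. n mod B"] by simp
  then have "word_code B u = word_code B z" using eq lt by simp
  then show ?case using snoc.IH[of z] snoc.prems w \<open>a = b\<close> by auto
qed

lemma computable_word_code: "computable_on list_encode (\<lambda>n. n) A (word_code B)"
proof (rule computable_onI)
  show "total_recursive 1 (\<lambda>xs. word_code B (list_decode (xs ! 0)))"
    unfolding word_code_def
    by (rule total_recursive_foldl[where f = "\<lambda>p c a. c * B + Suc a" and p = "\<lambda>xs. 0"]) (intro recs; simp)+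
qed simp

text \<open>
  With \<open>L = \<lfloor>log\<^sub>B x\<rfloor>\<close> the word has \<open>L + 1\<close> letters. Its first digit is \<open>\<lfloor>x / B\<^sup>L\<rfloor>\<close>, and deleting \<open>v\<close>
  letters leaves the remainder of \<open>x\<close> modulo \<open>B\<close> to the power \<open>L + 1 - v\<close>. The production depends on the
  first digit only, through two finite tables: the factor by which the remainder is shifted,
  and the code of the appended word.
\<close>

theorem tag_step_expressible:
  assumes T: "tag_system T" and B: "\<forall>a\<in>alphabet T. Suc a < B"
    and D: "D = {real (word_code B w) |w. w \<in> tag_words T \<and> tag_nonhalting T w}"
  shows "\<exists>f. expressible D f \<and> (\<forall>w\<in>tag_words T. tag_nonhalting T w \<longrightarrow>
    f (real (word_code B w)) = real (word_code B (tag_step T w)))"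
proof -
  define v where "v = deletion T"
  have v: "2 \<le> v" using T by (simp add: tag_system_def v_def)
  define lg where "lg x = (of_int \<lfloor>ln x / ln (real B)\<rfloor> :: real)" for x :: real
  define hd_digit where "hd_digit x = (of_int \<lfloor>x / real B powr lg x\<rfloor> :: real)" for x :: real
  define tl_weight where "tl_weight x = real B powr (lg x + 1 - real v)" for x :: real
  define out where "out x = (x - tl_weight x * of_int \<lfloor>x / tl_weight x\<rfloor>) *
      real (B ^ length (production T (nat \<lfloor>hd_digit x\<rfloor> - 1))) +
      real (word_code B (production T (nat \<lfloor>hd_digit x\<rfloor> - 1)))" for x :: real
  have digits: "\<forall>a\<in>set w. Suc a < B" if "w \<in> tag_words T" for w
    using that B by auto
  \<comment> \<open>The digits below the first contribute less than \<open>B\<close> to the power \<open>length w - 1\<close>, and those below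
    the first \<open>v\<close> less than \<open>tl_weight x\<close>; this determines all three floors.\<close>
  have analyse: "1 < x \<and> 2 \<le> B \<and> lg x = real (length w - 1) \<and> hd_digit x = real (Suc (hd w)) \<and>
     tl_weight x = real B ^ (length w - v) \<and>
     x - tl_weight x * of_int \<lfloor>x / tl_weight x\<rfloor> = real (word_code B (drop v w))"
    if w: "w \<in> tag_words T" "v \<le> length w" and x: "x = real (word_code B w)" for w x
  proof -
    obtain a w' where aw: "w = a # w'" using w(2) v by (cases w) auto
    have a: "Suc a < B" using digits[OF w(1)] aw by auto
    then have B2: "2 \<le> B" "0 < ln (real B)" by auto
    have dw: "\<forall>a\<in>set w'. Suc a < B" "\<forall>a\<in>set (drop v w). Suc a < B"
      using digits[OF w(1)] unfolding aw by (simp, meson in_set_dropD)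
    have x_eq: "x = real (Suc a) * real B ^ length w' + real (word_code B w')"
      using x aw by (simp add: word_code_Cons algebra_simps)
    have r: "real (word_code B w') < real B ^ length w'"
      using word_code_less[OF dw(1)] by (metis of_nat_less_iff of_nat_power)
    have lo: "real B ^ length w' \<le> x"
      using x_eq mult_right_mono[of 1 "real (Suc a)" "real B ^ length w'"] by simp
    have hi: "x < real B ^ Suc (length w')"
      using word_code_less[OF digits[OF w(1)]] unfolding x aw
      by (metis length_Cons of_nat_less_iff of_nat_power)
    have x1: "1 < x"
    proof -
      have "1 \<le> length w'" using aw w(2) v by simp
      then have "real B ^ 1 \<le> real B ^ length w'" using B2(1) by (intro power_increasing) auto
      then have "real B ^ 1 \<le> x" using lo by (rule order_trans)
      then show ?thesis using B2(1) by simp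
    qed
    have "real (length w') * ln (real B) \<le> ln x"
      using lo x1 B2 by (subst ln_realpow[symmetric]) auto
    moreover have "ln x < real (Suc (length w')) * ln (real B)"
      using hi x1 B2 by (subst ln_realpow[symmetric]) auto
    ultimately have "\<lfloor>ln x / ln (real B)\<rfloor> = int (length w')"
      using B2(2) by (simp add: floor_eq_iff field_simps)
    then have lg: "lg x = real (length w')" by (simp add: lg_def)
    have powr: "real B powr real n = real B ^ n" for n using B2(1) by (simp add: powr_realpow)
    have "\<lfloor>x / real B ^ length w'\<rfloor> = int (Suc a)"
      using x_eq r B2(1) by (simp add: floor_eq_iff field_simps)
    then have hd: "hd_digit x = real (Suc a)" by (simp add: hd_digit_def lg powr)
    have "lg x + 1 - real v = real (length w - v)" using lg aw w(2) by (simp add: of_nat_diff)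
    then have weight: "tl_weight x = real B ^ (length w - v)" unfolding tl_weight_def by (simp only: powr)
    have split: "x = real (word_code B (take v w)) * tl_weight x + real (word_code B (drop v w))"
      using word_code_append[of B "take v w" "drop v w"] x weight by simp
    have "real (word_code B (drop v w)) < tl_weight x"
      using word_code_less[OF dw(2)] unfolding weight by (metis length_drop of_nat_less_iff of_nat_power)
    moreover have "0 < tl_weight x" unfolding weight using B2(1) by simp
    ultimately have "\<lfloor>x / tl_weight x\<rfloor> = int (word_code B (take v w))"
      using split by (simp add: floor_eq_iff field_simps)
    then have "x - tl_weight x * of_int \<lfloor>x / tl_weight x\<rfloor> = real (word_code B (drop v w))"
      using split by (simp add: mult.commute)
    then show ?thesis using x1 B2 lg hd weight aw by simp
  qed
  have D': "\<exists>w. w \<in> tag_words T \<and> v \<le> length w \<and> x = real (word_code B w)" if "x \<in> D" for x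
    using that unfolding D tag_nonhalting_def v_def by blast
  interpret above_one D
    by unfold_locales (use D' analyse in blast)
  have B2: "2 \<le> B" if "x \<in> D" for x using D'[OF that] analyse by blast
  have lg: "expressible D lg"
    unfolding lg_def using base B2 by (intro expressible_floor expressible_ln expressible_of_nat expressible_var) force+
  have hd: "expressible D hd_digit"
    unfolding hd_digit_def using base B2 by (intro expressible_floor expressible_divide expressible_powr expressible_of_nat expressible_var lg) force+
  have weight: "expressible D tl_weight"
    unfolding tl_weight_def using base B2 by (intro expressible_powr expressible_of_nat expressible_diff expressible_add expressible_one lg) force+
  have hd_bound: "\<exists>e<B. hd_digit x = real e" if x: "x \<in> D" for x
  proof -
    obtain w where w: "w \<in> tag_words T" "v \<le> length w" "x = real (word_code B w)"
      using D'[OF x] by blast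
    then have "hd w \<in> set w" using v by (cases w) auto
    then have "Suc (hd w) < B" using digits[OF w(1)] by blast
    then show ?thesis using analyse[OF w] by blast
  qed
  have "expressible D out"
    unfolding out_def
    by (intro expressible_add expressible_mult expressible_diff expressible_floor expressible_divide expressible_var weight
        expressible_tabulate[OF hd hd_bound, where f = "\<lambda>d. B ^ length (production T (d - 1))"]
        expressible_tabulate[OF hd hd_bound, where f = "\<lambda>d. word_code B (production T (d - 1))"])
      (use B2 in \<open>fastforce simp: tl_weight_def\<close>)
  moreover have "out (real (word_code B w)) = real (word_code B (tag_step T w))"
    if w: "w \<in> tag_words T" "tag_nonhalting T w" for w
  proof -
    let ?x = "real (word_code B w)"
    have "v \<le> length w" using w(2) by (simp add: tag_nonhalting_def v_def)
    note x = analyse[OF w(1) this refl]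
    have "hd_digit ?x = real (Suc (hd w))" using x by blast
    then have "nat \<lfloor>hd_digit ?x\<rfloor> - 1 = hd w" by (simp only: floor_of_nat nat_int diff_Suc_1)
    moreover have "?x - tl_weight ?x * of_int \<lfloor>?x / tl_weight ?x\<rfloor> = real (word_code B (drop v w))"
      using x by blast
    ultimately show ?thesis
      by (simp add: out_def tag_step_def v_def word_code_append)
  qed
  ultimately show ?thesis by blast
qed

theorem tag_system_simulated_by_lexp:
  assumes T: "tag_system (T :: nat tag_system)"
  shows "\<exists>B F. lexp_vars F = {0} \<and> constant_free F \<and>
    orbit_simulates (lexp_map F) T (\<lambda>w. of_nat (word_code B w))"
proof -
  define B where "B = Suc (Suc (Max (insert 0 (alphabet T))))"
  have fin: "finite (alphabet T)" using T by (simp add: tag_system_def)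
  have B: "\<forall>a\<in>alphabet T. Suc a < B" using fin by (auto simp: B_def less_Suc_eq_le)
  obtain f where f: "expressible {real (word_code B w) |w. w \<in> tag_words T \<and> tag_nonhalting T w} f"
    "\<And>w. w \<in> tag_words T \<Longrightarrow> tag_nonhalting T w \<Longrightarrow>
       f (real (word_code B w)) = real (word_code B (tag_step T w))"
    using tag_step_expressible[OF T B refl] by blast
  then obtain F where F: "denotes {real (word_code B w) |w. w \<in> tag_words T \<and> tag_nonhalting T w} F f"
    unfolding expressible_def by blast
  have eval: "lexp_map F (of_nat (word_code B w)) = Some (of_nat (word_code B (tag_step T w)))"
    if "w \<in> tag_words T" "tag_nonhalting T w" for w
  proof -
    have "lexp_map F (of_real (real (word_code B w))) = Some (of_real (f (real (word_code B w))))"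
      by (rule bspec[OF conjunct2[OF conjunct2[OF F[unfolded denotes_def]]]]) (use that in blast)
    then show ?thesis using f(2)[OF that] by simp
  qed
  have "inj_on (\<lambda>w. of_nat (word_code B w) :: complex) (tag_words T)"
    using B by (auto intro!: inj_onI word_code_inj)
  then have "orbit_simulates (lexp_map F) T (\<lambda>w. of_nat (word_code B w))"
    using eval by (simp add: orbit_simulates_def)
  then show ?thesis using F unfolding denotes_def by blast
qed

theorem corollary5p2:
  shows "\<exists>(T :: nat tag_system) (c :: nat list \<Rightarrow> nat) (F :: lexp).
    universal_tag_system T \<and>
    computable_on list_encode (\<lambda>n. n) (tag_words T) c \<and>
    lexp_vars F = {0} \<and> constant_free F \<and>
    orbit_simulates (lexp_map F) T (\<lambda>w. of_nat (c w))"
proof -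
  obtain T where T: "universal_tag_system T" using ex_universal_tag_system ..
  then have "tag_system T" by (simp add: universal_tag_system_def)
  then obtain B F where "lexp_vars F = {0}" "constant_free F"
    "orbit_simulates (lexp_map F) T (\<lambda>w. of_nat (word_code B w))"
    using tag_system_simulated_by_lexp by meson
  with T computable_word_code show ?thesis by (intro exI conjI)
qed

end
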